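(* Let $k$ be a field and let $A$ be a differential $k$-algebra of finite type. Then there is a nonnegative exhaustive filtration $G=\{G_iA\}_{i\in\mathbb{Z}}$ of $A$ such that the associated graded algebra $\mathrm{gr}^G A=\bigoplus_i G_iA/G_{i-1}A$ is a commutative, finitely generated, connected graded $k$-algebra.
   Context: All $k$-algebras are associative and unital. A filtration of a $k$-algebra $A$ is an ascending family $F=\{F_iA\}_{i\in\mathbb{Z}}$ of $k$-submodules of $A$ with $1\in F_0A$ and $F_iA\cdot F_jA\subset F_{i+j}A$ for all $i,j$. It is exhaustive if $A=\bigcup_i F_iA$ and nonnegative if $F_{-1}A=0$. A differential $k$-algebra of finite type is a $k$-algebra $A$ admitting a nonnegative exhaustive filtration $F$ such that the graded algebra $\mathrm{gr}^F A=\bigoplus_i F_iA/F_{i-1}A$ is a finitely generated module over its center $Z(\mathrm{gr}^F A)$, and $Z(\mathrm{gr}^F A)$ is a finitely generated $k$-algebra. A graded $k$-algebra $\bar A$ is connected if $\bar A=\bigoplus_{i\ge 0}\bar A_i$, $\bar A_0=k$, and each $\bar A_i$ is a finite dimensional $k$-vector space.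
   Formalization: The algebra A is assumed to be nonzero; for A = 0, which is formally a differential k-algebra of finite type, every associated graded algebra is 0, so its degree-zero part cannot equal k and the statement fails. *)

theory Defs
  imports "HOL-Algebra.Algebra"
begin

text \<open>
  Associative unital algebras over a commutative ring. The locale \<^locale>\<open>algebra\<close> of the library
  requires the algebra itself to be commutative.
\<close>

locale assoc_algebra = module R M + ring M for R and M (structure) +
  assumes smult_mult_left:
      "\<lbrakk>c \<in> carrier R; x \<in> carrier M; y \<in> carrier M\<rbrakk> \<Longrightarrow> (c \<odot>\<^bsub>M\<^esub> x) \<otimes>\<^bsub>M\<^esub> y = c \<odot>\<^bsub>M\<^esub> (x \<otimes>\<^bsub>M\<^esub> y)"
    and smult_mult_right:
      "\<lbrakk>c \<in> carrier R; x \<in> carrier M; y \<in> carrier M\<rbrakk> \<Longrightarrow> x \<otimes>\<^bsub>M\<^esub> (c \<odot>\<^bsub>M\<^esub> y) = c \<odot>\<^bsub>M\<^esub> (x \<otimes>\<^bsub>M\<^esub> y)"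

definition ring_center :: "('a, 'm) ring_scheme \<Rightarrow> 'a set" where
  "ring_center B = {z \<in> carrier B. \<forall>x \<in> carrier B. z \<otimes>\<^bsub>B\<^esub> x = x \<otimes>\<^bsub>B\<^esub> z}"

text \<open>
  The operator \<^const>\<open>hull\<close> gives the smallest submodule (resp. subalgebra) containing a set.
\<close>

definition finitely_generated_module ::
    "('k, 'n) ring_scheme \<Rightarrow> ('k, 'a, 'm) module_scheme \<Rightarrow> bool" where
  "finitely_generated_module K M \<longleftrightarrow>
     (\<exists>S. finite S \<and> S \<subseteq> carrier M \<and> (\<lambda>N. submodule N K M) hull S = carrier M)"

definition finitely_generated_algebra ::
    "('k, 'n) ring_scheme \<Rightarrow> ('k, 'a, 'm) module_scheme \<Rightarrow> bool" where
  "finitely_generated_algebra K B \<longleftrightarrow>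
     (\<exists>S. finite S \<and> S \<subseteq> carrier B \<and>
        (\<lambda>N. submodule N K B \<and> subring N B) hull S = carrier B)"

definition center_algebra :: "('k, 'a, 'm) module_scheme \<Rightarrow> ('k, 'a, 'm) module_scheme" where
  "center_algebra B = B\<lparr>carrier := ring_center B\<rparr>"

definition module_over_center :: "('k, 'a, 'm) module_scheme \<Rightarrow> ('a, 'a) module" where
  "module_over_center B =
     \<lparr>carrier = carrier B, monoid.mult = monoid.mult B, one = one B, ring.zero = ring.zero B, add = add B, smult = monoid.mult B\<rparr>"

locale algebra_filtration = assoc_algebra R M for R and M (structure) +
  fixes F :: "int \<Rightarrow> 'c set"
  assumes filtration_submodule: "submodule (F i) R M"
    and filtration_ascending: "F i \<subseteq> F (i + 1)"
    and filtration_one: "\<one>\<^bsub>M\<^esub> \<in> F 0"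
    and filtration_mult: "\<lbrakk>x \<in> F i; y \<in> F j\<rbrakk> \<Longrightarrow> x \<otimes>\<^bsub>M\<^esub> y \<in> F (i + j)"

definition exhaustive_filtration :: "('k, 'a, 'm) module_scheme \<Rightarrow> (int \<Rightarrow> 'a set) \<Rightarrow> bool" where
  "exhaustive_filtration A F \<longleftrightarrow> carrier A = (\<Union>i. F i)"

definition nonnegative_filtration :: "('k, 'a, 'm) module_scheme \<Rightarrow> (int \<Rightarrow> 'a set) \<Rightarrow> bool" where
  "nonnegative_filtration A F \<longleftrightarrow> F (-1) = {\<zero>\<^bsub>A\<^esub>}"

definition gr_quotient ::
    "('k, 'a, 'm) module_scheme \<Rightarrow> (int \<Rightarrow> 'a set) \<Rightarrow> int \<Rightarrow> 'a set monoid" where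
  "gr_quotient A F i = (A\<lparr>carrier := F i\<rparr>) A_Mod (F (i - 1))"

text \<open>
  An element of the associated graded algebra is a finitely supported family of cosets
  \<open>f i \<in> F i / F (i - 1)\<close>, where the zero of the \<open>i\<close>-th quotient is the coset \<open>F (i - 1)\<close>. The product
  extends \<open>(x + F (i - 1)) (y + F (j - 1)) = x y + F (i + j - 1)\<close> bilinearly; the product over
  \<^term>\<open>gr_quotient A F n\<close> below is a sum, since the library writes the factor group multiplicatively.
\<close>

definition assoc_graded ::
    "('k, 'a, 'm) module_scheme \<Rightarrow> (int \<Rightarrow> 'a set) \<Rightarrow> ('k, int \<Rightarrow> 'a set) module" where
  "assoc_graded A F =
     \<lparr>carrier = carrier (sum_group UNIV (gr_quotient A F)),
      monoid.mult = (\<lambda>f g n. finprod (gr_quotient A F n)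
                (\<lambda>i. rcoset_mult A (F (n - 1)) (f i) (g (n - i))) {i. f i \<noteq> F (i - 1)}),
      one = (\<lambda>i. if i = 0 then F (-1) +>\<^bsub>A\<^esub> \<one>\<^bsub>A\<^esub> else F (i - 1)),
      ring.zero = (\<lambda>i. F (i - 1)),
      add = (\<lambda>f g i. f i <+>\<^bsub>A\<^esub> g i),
      smult = (\<lambda>c f i. \<Union>x \<in> f i. F (i - 1) +>\<^bsub>A\<^esub> (c \<odot>\<^bsub>A\<^esub> x))\<rparr>"

definition gr_component ::
    "('k, 'a, 'm) module_scheme \<Rightarrow> (int \<Rightarrow> 'a set) \<Rightarrow> int \<Rightarrow> (int \<Rightarrow> 'a set) set" where
  "gr_component A F i = {f \<in> carrier (assoc_graded A F). \<forall>j. j \<noteq> i \<longrightarrow> f j = F (j - 1)}"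

locale graded_algebra = assoc_algebra R M for R and M (structure) +
  fixes C :: "int \<Rightarrow> 'c set"
  assumes component_submodule: "submodule (C i) R M"
    and component_one: "\<one>\<^bsub>M\<^esub> \<in> C 0"
    and component_mult: "\<lbrakk>x \<in> C i; y \<in> C j\<rbrakk> \<Longrightarrow> x \<otimes>\<^bsub>M\<^esub> y \<in> C (i + j)"
    and direct_sum: "b \<in> carrier M \<Longrightarrow>
      \<exists>!f. (\<forall>i. f i \<in> C i) \<and> finite {i. f i \<noteq> \<zero>\<^bsub>M\<^esub>} \<and> b = finsum M f {i. f i \<noteq> \<zero>\<^bsub>M\<^esub>}"

text \<open>
  Connectedness over a field: the structure map \<open>c \<mapsto> c 1\<close> identifies the field with the component of
  degree zero. A vector space is finite dimensional if it is spanned by a finite set.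
\<close>

locale connected_graded_algebra = R?: field R + graded_algebra R M C
  for R and M (structure) and C +
  assumes component_negative: "i < 0 \<Longrightarrow> C i = {\<zero>\<^bsub>M\<^esub>}"
    and component_zero: "bij_betw (\<lambda>c. c \<odot>\<^bsub>M\<^esub> \<one>\<^bsub>M\<^esub>) (carrier R) (C 0)"
    and component_finite_dim: "finitely_generated_module R (M\<lparr>carrier := C i\<rparr>)"

definition differential_algebra_of_finite_type ::
    "('k, 'n) ring_scheme \<Rightarrow> ('k, 'a, 'm) module_scheme \<Rightarrow> bool" where
  "differential_algebra_of_finite_type K A \<longleftrightarrow>
     assoc_algebra K A \<and>
     (\<exists>F. algebra_filtration K A F \<and> nonnegative_filtration A F \<and> exhaustive_filtration A F \<and>
        finitely_generated_module (center_algebra (assoc_graded A F))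
          (module_over_center (assoc_graded A F)) \<and>
        finitely_generated_algebra K (center_algebra (assoc_graded A F)))"

end

theory Submission
  imports Defs
begin

text \<open>
  Lift homogeneous generators of the center of \<open>gr A\<close> to elements \<open>z\<close> of degrees \<open>d\<close>, and homogeneous
  generators of \<open>gr A\<close> over its center to elements \<open>y\<close> of degrees \<open>e\<close>. The words \<open>z \<dots> z y\<close> of degree
  at most \<open>n\<close> span \<open>F n\<close>. Weight \<open>z\<close> by \<open>N d + 1\<close> and \<open>y\<close> by \<open>N e + W\<close>, and let \<open>G n\<close> be the span of all
  words in these generators of weight at most \<open>n\<close>. For \<open>W\<close> large and \<open>N\<close> much larger, the commutators
  involving a \<open>z\<close> have smaller weight than expected because their \<open>F\<close>-degree drops, and so do the products
  \<open>y y'\<close> because they are combinations of words with a single \<open>y\<close>. Hence \<open>gr\<^sup>G A\<close> is commutative, and it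
  is connected and finitely generated because the finitely many generators have positive weights.
\<close>

section \<open>The associated graded algebra of a nonnegative filtration\<close>

text \<open>The obstacle is that \<open>F\<close> controls neither noncommutativity nor size:
  \<open>F 0\<close> may already be noncommutative and infinite dimensional, and the commutator of
  two module generators need not drop in degree. What finiteness over the center gives instead is a
  rewriting: \<open>y y'\<close> becomes a combination of words with a single letter from
  \<open>Y\<close>. This saves one copy of \<open>W\<close> and costs an extra 1 for each letter
  from \<open>Z\<close>. A letter of degree 0 can be repeated without raising the
  \<open>F\<close>-degree, so the number of these letters is not bounded by the degree; but only
  finitely many commutators and products of generators have to be rewritten, so one bound
  \<open>L\<close> serves for all of them. The same extra 1 gives letters of degree 0 a positive
  weight, without which the components could be infinite dimensional. Since \<open>y y'\<close>
  itself has small weight, and not just the commutator, the classes of two letters from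
  \<open>Y\<close> multiply to zero in \<open>gr\<^sup>G A\<close>. No estimate beyond the
  generators is needed, because the Leibniz rule passes it on to all words.\<close>

locale nonnegative_filtered_algebra = algebra_filtration K A F
  for K and A (structure) and F +
  assumes nonnegative: "F (- 1) = {\<zero>}"
begin

abbreviation gr where "gr \<equiv> assoc_graded A F"
abbreviation Q where "Q \<equiv> gr_quotient A F"

section \<open>Pieces of the filtration, their cosets and quotients\<close>

lemma F_additive: "additive_subgroup (F n) A"
  using filtration_submodule[of n] by (simp add: additive_subgroup_def submodule_def)

lemma F_subgroup: "subgroup (F n) (add_monoid A)"
  using F_additive by (simp add: additive_subgroup_def)

lemma F_carrier: "F n \<subseteq> carrier A"
  using F_additive additive_subgroup.a_subset by blast

lemma F_in_carrier [simp, intro]: "x \<in> F n \<Longrightarrow> x \<in> carrier A"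
  using F_carrier by blast

lemma F_zero [simp]: "\<zero> \<in> F n"
  by (rule additive_subgroup.zero_closed[OF F_additive])

lemma F_add [simp]: "x \<in> F n \<Longrightarrow> y \<in> F n \<Longrightarrow> x \<oplus> y \<in> F n"
  by (rule additive_subgroup.a_closed[OF F_additive])

lemma F_inv [simp]: "x \<in> F n \<Longrightarrow> \<ominus> x \<in> F n"
  by (rule additive_subgroup.a_inv_closed[OF F_additive])

lemma F_smult [simp]: "c \<in> carrier K \<Longrightarrow> x \<in> F n \<Longrightarrow> c \<odot> x \<in> F n"
  by (rule submodule.smult_closed[OF filtration_submodule])

lemma F_mono: "i \<le> j \<Longrightarrow> F i \<subseteq> F j"
proof (induction j rule: int_ge_induct)
  case (step j)
  then show ?case using filtration_ascending[of j] by blast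
qed simp

lemma F_monoD: "x \<in> F i \<Longrightarrow> i \<le> j \<Longrightarrow> x \<in> F j"
  using F_mono by blast

lemma F_negative: "n < 0 \<Longrightarrow> F n = {\<zero>}"
  using F_mono[of n "-1"] nonnegative by auto

lemma F_mult: "x \<in> F i \<Longrightarrow> y \<in> F j \<Longrightarrow> i + j \<le> n \<Longrightarrow> x \<otimes> y \<in> F n"
  using filtration_mult F_monoD by blast

lemma F_finsum: "f \<in> S \<rightarrow> F n \<Longrightarrow> finsum A f S \<in> F n"
proof (induction S rule: infinite_finite_induct)
  case (insert x S)
  then have "f \<in> S \<rightarrow> carrier A" "f x \<in> carrier A" by auto
  with insert show ?case by simp
qed auto

lemma F_abelian_subgroup: "abelian_subgroup (F n) A"
  by (rule abelian_subgroupI3[OF F_additive]) (rule M.abelian_group_axioms)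

text \<open>Identities in \<open>gr\<close> are checked on representatives through this
  criterion.\<close>

lemma coset_eq_iff:
  assumes "x \<in> carrier A" "y \<in> carrier A"
  shows "F n +> x = F n +> y \<longleftrightarrow> x \<ominus> y \<in> F n"
proof -
  interpret abelian_subgroup "F n" A by (rule F_abelian_subgroup)
  show ?thesis
    using assms a_rcos_module[of y x] a_rcos_self[of x] a_repr_independence'[of x y]
    by (auto simp: a_minus_def)
qed

lemma coset_eq_F_iff: "x \<in> carrier A \<Longrightarrow> F n +> x = F n \<longleftrightarrow> x \<in> F n"
  using coset_eq_iff[of x \<zero> n] by (simp add: F_carrier a_minus_def)

lemma coset_eqD: "y \<in> F n +> x \<Longrightarrow> x \<in> carrier A \<Longrightarrow> F n +> y = F n +> x"
  using F_abelian_subgroup abelian_subgroup.a_repr_independence' by metis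

lemma coset_self: "x \<in> carrier A \<Longrightarrow> x \<in> F n +> x"
  using F_abelian_subgroup abelian_subgroup.a_rcos_self by metis

lemma coset_carrier: "y \<in> F n +> x \<Longrightarrow> x \<in> carrier A \<Longrightarrow> y \<in> carrier A"
  using F_carrier a_r_coset_subset_G by blast

lemma coset_in_F: "y \<in> F m +> x \<Longrightarrow> x \<in> F n \<Longrightarrow> m \<le> n \<Longrightarrow> y \<in> F n"
  unfolding a_r_coset_def' using F_monoD by auto

lemma coset_add:
  "x \<in> carrier A \<Longrightarrow> y \<in> carrier A \<Longrightarrow> (F n +> x) <+>\<^bsub>A\<^esub> (F n +> y) = F n +> (x \<oplus> y)"
  using F_abelian_subgroup abelian_subgroup.a_rcos_sum by metis

lemma
  shows Q_carrier: "carrier (Q n) = (\<lambda>x. F (n - 1) +> x) ` F n"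
    and Q_mult: "monoid.mult (Q n) = set_add A"
    and Q_one: "one (Q n) = F (n - 1)"
  by (auto simp: gr_quotient_def A_FactGroup_def FactGroup_def RCOSETS_def a_r_coset_def r_coset_def
      set_add_def set_mult_def fun_eq_iff)

text \<open>The quotient is formed inside \<open>F n\<close> rather than \<open>A\<close>, so
  \<open>F (n - 1)\<close> has to be a subgroup of the restricted structure; this is where the
  filtration must be ascending.\<close>

lemma Q_comm_group: "comm_group (Q n)"
proof -
  have m: "module K (A\<lparr>carrier := F n\<rparr>)"
    by (rule submodule.submodule_is_module[OF filtration_submodule]) unfold_locales
  then interpret N: abelian_group "A\<lparr>carrier := F n\<rparr>" by (rule module.axioms)
  have "subgroup (F (n - 1)) (add_monoid (A\<lparr>carrier := F n\<rparr>))"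
    using group.subgroup_incl[OF M.a_group F_subgroup F_subgroup F_mono, of "n - 1" n] by simp
  then have "abelian_subgroup (F (n - 1)) (A\<lparr>carrier := F n\<rparr>)"
    by (intro abelian_subgroupI3 additive_subgroupI N.abelian_group_axioms)
  then show ?thesis
    unfolding gr_quotient_def by (rule abelian_subgroup.a_factorgroup_is_comm_group)
qed

text \<open>Moves sums of cosets to sums of representatives in \<open>A\<close>. For infinite
  \<open>S\<close> both sides are the trivial coset by convention.\<close>

lemma finprod_Q_coset:
  assumes "g \<in> S \<rightarrow> F n"
  shows "finprod (Q n) (\<lambda>i. F (n - 1) +> g i) S = F (n - 1) +> finsum A g S"
proof -
  interpret Qn: comm_group "Q n" by (rule Q_comm_group)
  show ?thesis
    using assms
  proof (induction S rule: infinite_finite_induct)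
    case (insert x S)
    then have *: "g \<in> S \<rightarrow> F n" "g x \<in> F n" by auto
    then have "g \<in> S \<rightarrow> carrier A" "g x \<in> carrier A" by auto
    with * insert show ?case
      by (simp add: Q_carrier Q_mult Pi_def coset_add F_finsum)
  qed (auto simp: Q_one F_carrier)
qed

section \<open>Coset families and evaluation of their products\<close>

lemma
  shows gr_one: "\<one>\<^bsub>gr\<^esub> = (\<lambda>i. if i = 0 then F (- 1) +> \<one> else F (i - 1))"
    and gr_zero: "\<zero>\<^bsub>gr\<^esub> = (\<lambda>i. F (i - 1))"
    and gr_add: "f \<oplus>\<^bsub>gr\<^esub> g = (\<lambda>i. f i <+>\<^bsub>A\<^esub> g i)"
  by (simp_all add: assoc_graded_def)

lemma gr_carrier_iff:
  "f \<in> carrier gr \<longleftrightarrow> (\<forall>i. \<exists>x \<in> F i. f i = F (i - 1) +> x) \<and> finite {i. f i \<noteq> F (i - 1)}"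
proof -
  have "group (Q i)" for i using Q_comm_group by (simp add: comm_group_def)
  then show ?thesis
    by (simp add: assoc_graded_def carrier_sum_group Q_carrier Q_one PiE_def Pi_def image_iff)
qed

lemma gr_support_finite: "f \<in> carrier gr \<Longrightarrow> finite {i. f i \<noteq> F (i - 1)}"
  by (simp add: gr_carrier_iff)

lemma gr_carrierI:
  assumes "\<And>i. x i \<in> F i" "finite {i. x i \<notin> F (i - 1)}" "\<And>i. f i = F (i - 1) +> x i"
  shows "f \<in> carrier gr"
proof -
  have "f i = F (i - 1) \<longleftrightarrow> x i \<in> F (i - 1)" for i
    using assms coset_eq_F_iff F_in_carrier by metis
  with assms show ?thesis by (auto simp: gr_carrier_iff)
qed

text \<open>Representatives of trivial cosets are replaced by zero. The finite support of the family
  of cosets then becomes finite support of the representatives, which can serve as an index set for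
  sums in \<open>A\<close>.\<close>

lemma gr_repr:
  assumes "f \<in> carrier gr"
  obtains x where "\<And>i. x i \<in> F i" "\<And>i. f i = F (i - 1) +> x i"
    "\<And>i. x i \<in> F (i - 1) \<Longrightarrow> x i = \<zero>" "finite {i. x i \<noteq> \<zero>}"
proof -
  from assms obtain y where y: "\<And>i. y i \<in> F i" "\<And>i. f i = F (i - 1) +> y i"
    unfolding gr_carrier_iff by metis
  define x where "x i = (if y i \<in> F (i - 1) then \<zero> else y i)" for i
  have x: "f i = F (i - 1) +> x i" for i
    using y coset_eq_F_iff[of "y i" "i - 1"] by (auto simp: x_def F_carrier)
  have "{i. x i \<noteq> \<zero>} \<subseteq> {i. f i \<noteq> F (i - 1)}"
    using y(2) coset_eq_F_iff[OF F_in_carrier[OF y(1)]] by (auto simp: x_def)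
  then have "finite {i. x i \<noteq> \<zero>}"
    using gr_support_finite[OF assms] finite_subset by blast
  with x y show thesis by (intro that[of x]) (auto simp: x_def)
qed

text \<open>\<open>rcoset_mult\<close> is the union of the cosets of all products of
  representatives, so these must all agree. This follows from
  \<open>a b - x y = (a - x) b + x (b - y)\<close>, where each summand has a factor of degree one
  lower.\<close>

lemma coset_product:
  assumes "x \<in> F i" "y \<in> F j"
  shows "rcoset_mult A (F (i + j - 1)) (F (i - 1) +> x) (F (j - 1) +> y) = F (i + j - 1) +> x \<otimes> y"
proof -
  have "F (i + j - 1) +> a \<otimes> b = F (i + j - 1) +> x \<otimes> y"
    if ab: "a \<in> F (i - 1) +> x" "b \<in> F (j - 1) +> y" for a b
  proof -
    have [simp]: "x \<in> carrier A" "y \<in> carrier A" using assms by auto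
    have [simp]: "a \<in> carrier A" "b \<in> carrier A" using ab coset_carrier assms by blast+
    have "a \<ominus> x \<in> F (i - 1)" "b \<ominus> y \<in> F (j - 1)"
      using ab assms by (auto simp: coset_eqD simp flip: coset_eq_iff)
    moreover have "b \<in> F j" using ab(2) assms(2) coset_in_F by force
    ultimately have "(a \<ominus> x) \<otimes> b \<in> F (i + j - 1)" "x \<otimes> (b \<ominus> y) \<in> F (i + j - 1)"
      using assms by (auto intro: F_mult)
    then have "(a \<ominus> x) \<otimes> b \<oplus> x \<otimes> (b \<ominus> y) \<in> F (i + j - 1)" by simp
    also have "(a \<ominus> x) \<otimes> b \<oplus> x \<otimes> (b \<ominus> y) = a \<otimes> b \<ominus> x \<otimes> y"
      by (simp add: a_minus_def l_distr r_distr l_minus r_minus M.a_ac M.r_neg1 M.r_neg2)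
    finally show ?thesis by (simp add: coset_eq_iff)
  qed
  moreover have "F (i - 1) +> x \<noteq> {}" "F (j - 1) +> y \<noteq> {}" using assms coset_self by auto
  ultimately show ?thesis by (simp add: rcoset_mult_def)
qed

text \<open>The definition sums over the support of \<open>f\<close>. Any finite \<open>T\<close>
  outside of which the terms of degree \<open>n\<close> vanish will do as well, and this freedom is
  exploited below: a single index suffices for a homogeneous factor, and a reflected support serves
  for the commutativity proof.\<close>

lemma gr_mult_eval:
  assumes x: "\<And>i. x i \<in> F i" "\<And>i. f i = F (i - 1) +> x i"
    and y: "\<And>i. y i \<in> F i" "\<And>i. g i = F (i - 1) +> y i"
    and f: "finite {i. f i \<noteq> F (i - 1)}"
    and T: "finite T" "\<And>i. i \<notin> T \<Longrightarrow> x i \<in> F (i - 1) \<or> y (n - i) \<in> F (n - i - 1)"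
  shows "(f \<otimes>\<^bsub>gr\<^esub> g) n = F (n - 1) +> (\<Oplus>i \<in> T. x i \<otimes> y (n - i))"
proof -
  interpret Qn: comm_group "Q n" by (rule Q_comm_group)
  have xy: "x i \<otimes> y (n - i) \<in> F n" for i
    using x y by (intro F_mult[of _ i _ "n - i"]) auto
  have xy0: "x i \<otimes> y (n - i) \<in> F (n - 1)"
    if "x i \<in> F (i - 1) \<or> y (n - i) \<in> F (n - i - 1)" for i
    using that x(1)[of i] y(1)[of "n - i"] F_mult[of "x i" "i - 1" "y (n - i)" "n - i" "n - 1"]
      F_mult[of "x i" i "y (n - i)" "n - i - 1" "n - 1"] by auto
  have *: "rcoset_mult A (F (n - 1)) (f i) (g (n - i)) = F (n - 1) +> x i \<otimes> y (n - i)" for i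
    using coset_product[OF x(1)[of i] y(1)[of "n - i"]] by (simp add: x(2) y(2))
  have "(f \<otimes>\<^bsub>gr\<^esub> g) n = finprod (Q n) (\<lambda>i. F (n - 1) +> x i \<otimes> y (n - i)) {i. f i \<noteq> F (i - 1)}"
    by (simp add: assoc_graded_def *)
  also have "\<dots> = finprod (Q n) (\<lambda>i. F (n - 1) +> x i \<otimes> y (n - i)) T"
  proof (rule Qn.finprod_mono_neutral_cong)
    fix i
    have *: "F (n - 1) +> x i \<otimes> y (n - i) = F (n - 1)"
      if "x i \<in> F (i - 1) \<or> y (n - i) \<in> F (n - i - 1)"
      using xy0[OF that] by (simp add: coset_eq_F_iff)
    show "F (n - 1) +> x i \<otimes> y (n - i) = \<one>\<^bsub>Q n\<^esub>" if "i \<in> T - {i. f i \<noteq> F (i - 1)}"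
      using that * x(2)[of i] coset_eq_F_iff[OF F_in_carrier[OF x(1)[of i]], of "i - 1"]
      by (auto simp only: Q_one)
    show "F (n - 1) +> x i \<otimes> y (n - i) = \<one>\<^bsub>Q n\<^esub>" if "i \<in> {i. f i \<noteq> F (i - 1)} - T"
      using that * T(2)[of i] by (auto simp only: Q_one)
  qed (use f T xy in \<open>auto simp: Q_carrier\<close>)
  also have "\<dots> = F (n - 1) +> (\<Oplus>i \<in> T. x i \<otimes> y (n - i))"
    using xy by (intro finprod_Q_coset) auto
  finally show ?thesis .
qed

text \<open>As for products, the union over all representatives collapses to one coset, because
  \<open>c (a - x)\<close> stays in \<open>F (i - 1)\<close>.\<close>

lemma gr_smult_eval:
  assumes "c \<in> carrier K" "x \<in> F i" "f i = F (i - 1) +> x"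
  shows "(c \<odot>\<^bsub>gr\<^esub> f) i = F (i - 1) +> c \<odot> x"
proof -
  have "F (i - 1) +> c \<odot> a = F (i - 1) +> c \<odot> x" if a: "a \<in> F (i - 1) +> x" for a
  proof -
    have [simp]: "x \<in> carrier A" using assms by auto
    have [simp]: "a \<in> carrier A" using a coset_carrier assms by blast
    have "a \<ominus> x \<in> F (i - 1)"
      using a assms by (auto simp: coset_eqD simp flip: coset_eq_iff)
    then have "c \<odot> (a \<ominus> x) \<in> F (i - 1)" using assms by simp
    also have "c \<odot> (a \<ominus> x) = c \<odot> a \<ominus> c \<odot> x"
      using assms by (simp add: a_minus_def smult_r_distr smult_r_minus)
    finally show ?thesis using assms by (simp add: coset_eq_iff)
  qed
  moreover have "F (i - 1) +> x \<noteq> {}" using assms coset_self by auto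
  ultimately show ?thesis using assms(3) by (simp add: assoc_graded_def)
qed

lemma gr_zero_carrier: "\<zero>\<^bsub>gr\<^esub> \<in> carrier gr"
  by (rule gr_carrierI[of "\<lambda>_. \<zero>"]) (auto simp: gr_zero F_carrier)

lemma F_one [simp]: "\<one> \<in> F 0"
  by (rule filtration_one)

lemma gr_add_eval:
  "x \<in> F i \<Longrightarrow> y \<in> F i \<Longrightarrow> f i = F (i - 1) +> x \<Longrightarrow> g i = F (i - 1) +> y
    \<Longrightarrow> (f \<oplus>\<^bsub>gr\<^esub> g) i = F (i - 1) +> (x \<oplus> y)"
  by (simp add: gr_add coset_add)

lemma gr_smult_carrier:
  assumes "c \<in> carrier K" "f \<in> carrier gr"
  shows "c \<odot>\<^bsub>gr\<^esub> f \<in> carrier gr"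
proof -
  obtain x where x: "\<And>i. x i \<in> F i" "\<And>i. f i = F (i - 1) +> x i" "finite {i. x i \<noteq> \<zero>}"
    using gr_repr[OF assms(2)] by metis
  show ?thesis
  proof (rule gr_carrierI[of "\<lambda>i. c \<odot> x i"])
    have "{i. c \<odot> x i \<notin> F (i - 1)} \<subseteq> {i. x i \<noteq> \<zero>}" using assms by auto
    with x show "finite {i. c \<odot> x i \<notin> F (i - 1)}" using finite_subset by blast
  qed (use x assms in \<open>auto simp: gr_smult_eval\<close>)
qed

text \<open>
  The ring axioms for the associated graded algebra are transported along the surjection from the
  Rees ring, the subring of polynomials whose \<open>i\<close>-th coefficient lies in \<open>F i\<close>.
\<close>

definition rees :: "(nat \<Rightarrow> 'c) set" where
  "rees = {p \<in> up A. \<forall>i. p i \<in> F (int i)}"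

definition rees_repr :: "(nat \<Rightarrow> 'c) \<Rightarrow> int \<Rightarrow> 'c" where
  "rees_repr p i = (if i < 0 then \<zero> else p (nat i))"

definition rees_map :: "(nat \<Rightarrow> 'c) \<Rightarrow> int \<Rightarrow> 'c set" where
  "rees_map p i = F (i - 1) +> rees_repr p i"

lemma
  assumes "p \<in> rees"
  shows rees_up: "p \<in> up A" and rees_F: "p i \<in> F (int i)" and rees_carrier: "p i \<in> carrier A"
  using assms by (auto simp: rees_def)

lemma reesI: "p \<in> up A \<Longrightarrow> (\<And>i. p i \<in> F (int i)) \<Longrightarrow> p \<in> rees"
  by (simp add: rees_def)

lemma
  shows UP_zero: "\<zero>\<^bsub>UP A\<^esub> = (\<lambda>i. \<zero>)"
    and UP_one: "\<one>\<^bsub>UP A\<^esub> = (\<lambda>i. if i = 0 then \<one> else \<zero>)"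
    and UP_carrier: "carrier (UP A) = up A"
  by (simp_all add: UP_def)

lemma
  assumes "p \<in> rees" "q \<in> rees"
  shows rees_add: "p \<oplus>\<^bsub>UP A\<^esub> q = (\<lambda>i. p i \<oplus> q i)"
    and rees_mult: "p \<otimes>\<^bsub>UP A\<^esub> q = (\<lambda>n. \<Oplus>i \<in> {..n}. p i \<otimes> q (n - i))"
  using rees_up[OF assms(1)] rees_up[OF assms(2)] by (simp_all add: UP_def)

lemma rees_subring: "subring rees (UP A)"
proof -
  interpret U: UP_ring A "UP A" by unfold_locales
  show ?thesis
  proof (rule U.P.subringI)
    show "rees \<subseteq> carrier (UP A)" by (simp add: rees_def UP_carrier)
    show "\<one>\<^bsub>UP A\<^esub> \<in> rees"
      unfolding UP_one by (rule reesI[OF up_one_closed]) simp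
  next
    fix p assume p: "p \<in> rees"
    \<comment> \<open>The additive inverse in \<open>UP A\<close> is not pointwise by definition; it
      is identified by uniqueness with this candidate.\<close>
    have q: "(\<lambda>i. \<ominus> p i) \<in> rees"
      by (rule reesI[OF up_a_inv_closed[OF rees_up[OF p]] F_inv[OF rees_F[OF p]]])
    have "(\<lambda>i. \<ominus> p i) \<oplus>\<^bsub>UP A\<^esub> p = \<zero>\<^bsub>UP A\<^esub>"
      by (simp add: rees_add[OF q p] UP_zero M.l_neg rees_carrier[OF p])
    then have "\<ominus>\<^bsub>UP A\<^esub> p = (\<lambda>i. \<ominus> p i)"
      using U.P.minus_equality rees_up p q UP_carrier by metis
    with q show "\<ominus>\<^bsub>UP A\<^esub> p \<in> rees" by simp
  next
    fix p q assume p: "p \<in> rees" and q: "q \<in> rees"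
    show "p \<oplus>\<^bsub>UP A\<^esub> q \<in> rees"
      unfolding rees_add[OF p q]
      by (rule reesI[OF up_add_closed[OF rees_up[OF p] rees_up[OF q]] F_add[OF rees_F[OF p] rees_F[OF q]]])
    have "p i \<otimes> q (n - i) \<in> F (int n)" if "i \<le> n" for i n
      using that by (intro F_mult[OF rees_F[OF p, of i] rees_F[OF q, of "n - i"]]) simp
    then show "p \<otimes>\<^bsub>UP A\<^esub> q \<in> rees"
      unfolding rees_mult[OF p q]
      by (intro reesI[OF up_mult_closed[OF rees_up[OF p] rees_up[OF q]]] F_finsum Pi_I) simp
  qed
qed

lemma rees_repr_in_F: "p \<in> rees \<Longrightarrow> rees_repr p i \<in> F i"
  using rees_F[of p "nat i"] by (cases "i < 0") (simp_all add: rees_repr_def)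

lemma rees_repr_bounded:
  assumes "p \<in> rees" shows "finite {i. rees_repr p i \<noteq> \<zero>}"
proof -
  obtain n where n: "bound \<zero> n p" using bound_upD[OF rees_up[OF assms]] by metis
  have "rees_repr p i = \<zero>" if "i \<notin> {0..int n}" for i
    using that bound.bound[OF n, of "nat i"] by (auto simp: rees_repr_def)
  then have "{i. rees_repr p i \<noteq> \<zero>} \<subseteq> {0..int n}" by blast
  then show ?thesis using finite_subset by blast
qed

lemma rees_map_carrier:
  assumes "p \<in> rees" shows "rees_map p \<in> carrier gr"
proof (rule gr_carrierI[of "rees_repr p"])
  have "{i. rees_repr p i \<notin> F (i - 1)} \<subseteq> {i. rees_repr p i \<noteq> \<zero>}" by auto
  then show "finite {i. rees_repr p i \<notin> F (i - 1)}"
    using rees_repr_bounded[OF assms] finite_subset by blast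
qed (use assms in \<open>auto simp: rees_map_def rees_repr_in_F\<close>)

text \<open>Nonnegativity enters here: representatives in negative degrees are zero, so a family of
  cosets is determined by natural exponents, and finite support makes it a polynomial.\<close>

lemma rees_map_surj: "rees_map ` rees = carrier gr"
proof (intro subset_antisym subsetI)
  fix f assume f: "f \<in> carrier gr"
  obtain x where x: "\<And>i. x i \<in> F i" "\<And>i. f i = F (i - 1) +> x i" "finite {i. x i \<noteq> \<zero>}"
    using gr_repr[OF f] by metis
  define p where "p n = x (int n)" for n
  from x(3) have "bdd_above {i. x i \<noteq> \<zero>}" by (rule bdd_above_finite)
  then obtain N where N: "\<And>i. x i \<noteq> \<zero> \<Longrightarrow> i \<le> N" by (auto simp: bdd_above_def)
  have "bound \<zero> (nat N) p"
  proof
    fix m assume "nat N < m"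
    then have "\<not> int m \<le> N" by linarith
    then show "p m = \<zero>" using N[of "int m"] by (auto simp: p_def)
  qed
  then have "p \<in> rees"
    using x(1) F_in_carrier[OF x(1)] by (intro reesI mem_upI) (auto simp: p_def)
  moreover have "rees_repr p i = x i" for i
    using x(1)[of i] F_negative[of i] by (auto simp: rees_repr_def p_def)
  then have "rees_map p = f" using x by (auto simp: rees_map_def fun_eq_iff)
  ultimately show "f \<in> rees_map ` rees" by blast
qed (auto simp: rees_map_carrier)

lemma rees_map_mult:
  assumes p: "p \<in> rees" and q: "q \<in> rees"
  shows "rees_map (p \<otimes>\<^bsub>UP A\<^esub> q) = rees_map p \<otimes>\<^bsub>gr\<^esub> rees_map q"
proof
  fix n
  \<comment> \<open>For negative \<open>n\<close> the index set is still \<open>{0}\<close>, but its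
    only term is zero because \<open>rees_repr q n\<close> is.\<close>
  have "(rees_map p \<otimes>\<^bsub>gr\<^esub> rees_map q) n
      = F (n - 1) +> (\<Oplus>i\<in>int ` {..nat n}. rees_repr p i \<otimes> rees_repr q (n - i))"
  proof (rule gr_mult_eval)
    fix i assume i: "i \<notin> int ` {..nat n}"
    then have "i < 0 \<or> n - i < 0" by (cases i) auto
    then show "rees_repr p i \<in> F (i - 1) \<or> rees_repr q (n - i) \<in> F (n - i - 1)"
      by (auto simp: rees_repr_def)
  qed (use p q rees_repr_in_F gr_support_finite[OF rees_map_carrier[OF p]] in \<open>simp_all add: rees_map_def\<close>)
  also have "(\<Oplus>i\<in>int ` {..nat n}. rees_repr p i \<otimes> rees_repr q (n - i))
      = (\<Oplus>i\<in>{..nat n}. rees_repr p (int i) \<otimes> rees_repr q (n - int i))"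
    using p q rees_repr_in_F
    by (intro M.add.finprod_reindex) (auto intro: F_in_carrier[OF rees_repr_in_F])
  also have "\<dots> = rees_repr (p \<otimes>\<^bsub>UP A\<^esub> q) n"
  proof (cases "n < 0")
    case True
    then show ?thesis by (simp add: rees_repr_def rees_carrier[OF p])
  next
    case False
    have "rees_repr q (n - int i) = q (nat n - i)" if "i \<le> nat n" for i
      using that False by (auto simp: rees_repr_def nat_diff_distrib)
    with False show ?thesis
      by (auto simp: rees_repr_def rees_mult[OF p q] rees_carrier[OF p] rees_carrier[OF q]
          intro!: M.add.finprod_cong')
  qed
  finally show "rees_map (p \<otimes>\<^bsub>UP A\<^esub> q) n = (rees_map p \<otimes>\<^bsub>gr\<^esub> rees_map q) n"
    by (simp only: rees_map_def[of "p \<otimes>\<^bsub>UP A\<^esub> q" n])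
qed

lemma gr_ring: "ring gr"
proof -
  interpret U: UP_ring A "UP A" by unfold_locales
  interpret S: ring "UP A\<lparr>carrier := rees\<rparr>" by (rule U.P.subring_is_ring[OF rees_subring])
  have "rees_map \<in> ring_hom (UP A\<lparr>carrier := rees\<rparr>) gr"
  proof (rule ring_hom_memI)
    fix p q assume "p \<in> carrier (UP A\<lparr>carrier := rees\<rparr>)" "q \<in> carrier (UP A\<lparr>carrier := rees\<rparr>)"
    then have pq: "p \<in> rees" "q \<in> rees" by auto
    then show "rees_map (p \<otimes>\<^bsub>UP A\<lparr>carrier := rees\<rparr>\<^esub> q) = rees_map p \<otimes>\<^bsub>gr\<^esub> rees_map q"
      by (simp add: rees_map_mult)
    have "rees_repr (p \<oplus>\<^bsub>UP A\<^esub> q) i = rees_repr p i \<oplus> rees_repr q i" for i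
      by (simp add: rees_repr_def rees_add[OF pq])
    then show "rees_map (p \<oplus>\<^bsub>UP A\<lparr>carrier := rees\<rparr>\<^esub> q) = rees_map p \<oplus>\<^bsub>gr\<^esub> rees_map q"
      by (simp add: rees_map_def fun_eq_iff gr_add coset_add
          F_in_carrier[OF rees_repr_in_F[OF pq(1)]] F_in_carrier[OF rees_repr_in_F[OF pq(2)]])
  next
    show "rees_map \<one>\<^bsub>UP A\<lparr>carrier := rees\<rparr>\<^esub> = \<one>\<^bsub>gr\<^esub>"
      by (simp add: rees_map_def fun_eq_iff gr_one UP_one rees_repr_def F_carrier)
  qed (simp add: rees_map_carrier)
  \<comment> \<open>The image comes with its own carrier and zero; surjectivity and the computation
    of the image of zero identify them with those of \<open>gr\<close>.\<close>
  from S.ring_hom_imp_img_ring[OF this] have "ring (gr\<lparr>carrier := carrier gr, zero := rees_map \<zero>\<^bsub>UP A\<^esub>\<rparr>)"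
    by (simp add: rees_map_surj)
  moreover have "rees_map \<zero>\<^bsub>UP A\<^esub> = \<zero>\<^bsub>gr\<^esub>"
    by (simp add: rees_map_def fun_eq_iff gr_zero UP_zero rees_repr_def F_carrier)
  ultimately show ?thesis by simp
qed

text \<open>Polynomials over \<open>A\<close> carry scalars from \<open>A\<close> and not from
  \<open>K\<close>, so the module axioms, unlike the ring axioms, are checked on
  representatives.\<close>

lemma gr_module: "module K gr"
proof -
  interpret G: ring gr by (rule gr_ring)
  have repr: "\<exists>x. (\<forall>i. x i \<in> F i) \<and> (\<forall>i. f i = F (i - 1) +> x i)" if "f \<in> carrier gr" for f
    using gr_repr[OF that] by metis
  show ?thesis
  proof (rule moduleI)
    show "cring K" by (rule R.cring_axioms)
    show "abelian_group gr" by (rule G.abelian_group_axioms)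
    fix a f assume a: "a \<in> carrier K" and f: "f \<in> carrier gr"
    show "a \<odot>\<^bsub>gr\<^esub> f \<in> carrier gr" using a f by (rule gr_smult_carrier)
  next
    fix f assume f: "f \<in> carrier gr"
    obtain x where x: "\<And>i. x i \<in> F i" "\<And>i. f i = F (i - 1) +> x i" using repr[OF f] by metis
    show "\<one>\<^bsub>K\<^esub> \<odot>\<^bsub>gr\<^esub> f = f"
    proof
      fix i
      have "(\<one>\<^bsub>K\<^esub> \<odot>\<^bsub>gr\<^esub> f) i = F (i - 1) +> \<one>\<^bsub>K\<^esub> \<odot> x i"
        by (rule gr_smult_eval[OF R.one_closed x])
      then show "(\<one>\<^bsub>K\<^esub> \<odot>\<^bsub>gr\<^esub> f) i = f i"
        by (simp only: smult_one[OF F_in_carrier[OF x(1)]] x(2)[symmetric])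
    qed
  next
    fix a b f assume a: "a \<in> carrier K" and b: "b \<in> carrier K" and f: "f \<in> carrier gr"
    obtain x where x: "\<And>i. x i \<in> F i" "\<And>i. f i = F (i - 1) +> x i" using repr[OF f] by metis
    show "(a \<oplus>\<^bsub>K\<^esub> b) \<odot>\<^bsub>gr\<^esub> f = a \<odot>\<^bsub>gr\<^esub> f \<oplus>\<^bsub>gr\<^esub> b \<odot>\<^bsub>gr\<^esub> f"
    proof
      fix i
      have "(a \<odot>\<^bsub>gr\<^esub> f \<oplus>\<^bsub>gr\<^esub> b \<odot>\<^bsub>gr\<^esub> f) i = F (i - 1) +> (a \<odot> x i \<oplus> b \<odot> x i)"
        by (rule gr_add_eval[OF F_smult[OF a x(1)] F_smult[OF b x(1)] gr_smult_eval[OF a x] gr_smult_eval[OF b x]])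
      moreover have "((a \<oplus>\<^bsub>K\<^esub> b) \<odot>\<^bsub>gr\<^esub> f) i = F (i - 1) +> (a \<oplus>\<^bsub>K\<^esub> b) \<odot> x i"
        using a b by (intro gr_smult_eval[OF _ x]) simp
      ultimately show "((a \<oplus>\<^bsub>K\<^esub> b) \<odot>\<^bsub>gr\<^esub> f) i = (a \<odot>\<^bsub>gr\<^esub> f \<oplus>\<^bsub>gr\<^esub> b \<odot>\<^bsub>gr\<^esub> f) i"
        by (simp only: smult_l_distr[OF a b F_in_carrier[OF x(1)]])
    qed
    show "(a \<otimes>\<^bsub>K\<^esub> b) \<odot>\<^bsub>gr\<^esub> f = a \<odot>\<^bsub>gr\<^esub> (b \<odot>\<^bsub>gr\<^esub> f)"
    proof
      fix i
      have "(a \<odot>\<^bsub>gr\<^esub> (b \<odot>\<^bsub>gr\<^esub> f)) i = F (i - 1) +> a \<odot> (b \<odot> x i)"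
        by (rule gr_smult_eval[OF a F_smult[OF b x(1)] gr_smult_eval[OF b x]])
      moreover have "((a \<otimes>\<^bsub>K\<^esub> b) \<odot>\<^bsub>gr\<^esub> f) i = F (i - 1) +> (a \<otimes>\<^bsub>K\<^esub> b) \<odot> x i"
        using a b by (intro gr_smult_eval[OF _ x]) simp
      ultimately show "((a \<otimes>\<^bsub>K\<^esub> b) \<odot>\<^bsub>gr\<^esub> f) i = (a \<odot>\<^bsub>gr\<^esub> (b \<odot>\<^bsub>gr\<^esub> f)) i"
        by (simp only: smult_assoc1[OF a b F_in_carrier[OF x(1)]])
    qed
  next
    fix a f g assume a: "a \<in> carrier K" and f: "f \<in> carrier gr" and g: "g \<in> carrier gr"
    obtain x where x: "\<And>i. x i \<in> F i" "\<And>i. f i = F (i - 1) +> x i" using repr[OF f] by metis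
    obtain y where y: "\<And>i. y i \<in> F i" "\<And>i. g i = F (i - 1) +> y i" using repr[OF g] by metis
    show "a \<odot>\<^bsub>gr\<^esub> (f \<oplus>\<^bsub>gr\<^esub> g) = a \<odot>\<^bsub>gr\<^esub> f \<oplus>\<^bsub>gr\<^esub> a \<odot>\<^bsub>gr\<^esub> g"
    proof
      fix i
      have "(a \<odot>\<^bsub>gr\<^esub> f \<oplus>\<^bsub>gr\<^esub> a \<odot>\<^bsub>gr\<^esub> g) i = F (i - 1) +> (a \<odot> x i \<oplus> a \<odot> y i)"
        by (rule gr_add_eval[OF F_smult[OF a x(1)] F_smult[OF a y(1)] gr_smult_eval[OF a x] gr_smult_eval[OF a y]])
      moreover have "(a \<odot>\<^bsub>gr\<^esub> (f \<oplus>\<^bsub>gr\<^esub> g)) i = F (i - 1) +> a \<odot> (x i \<oplus> y i)"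
        by (rule gr_smult_eval[OF a F_add[OF x(1) y(1)] gr_add_eval[OF x(1) y(1) x(2) y(2)]])
      ultimately show "(a \<odot>\<^bsub>gr\<^esub> (f \<oplus>\<^bsub>gr\<^esub> g)) i = (a \<odot>\<^bsub>gr\<^esub> f \<oplus>\<^bsub>gr\<^esub> a \<odot>\<^bsub>gr\<^esub> g) i"
        by (simp only: smult_r_distr[OF a F_in_carrier[OF x(1)] F_in_carrier[OF y(1)]])
    qed
  qed
qed

text \<open>One index set, the support of the representatives of \<open>f\<close>, serves for all
  the products involved, so the sums can be compared term by term.\<close>

lemma gr_assoc_algebra: "assoc_algebra K gr"
proof -
  have "assoc_algebra_axioms K gr"
  proof
    fix c f g assume c: "c \<in> carrier K" and f: "f \<in> carrier gr" and g: "g \<in> carrier gr"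
    obtain x where x: "\<And>i. x i \<in> F i" "\<And>i. f i = F (i - 1) +> x i" "finite {i. x i \<noteq> \<zero>}"
      using gr_repr[OF f] by metis
    obtain y where y: "\<And>i. y i \<in> F i" "\<And>i. g i = F (i - 1) +> y i" "finite {i. y i \<noteq> \<zero>}"
      using gr_repr[OF g] by metis
    let ?T = "{i. x i \<noteq> \<zero>}"
    have [simp]: "x i \<in> carrier A" "y i \<in> carrier A" for i
      by (rule F_in_carrier[OF x(1)], rule F_in_carrier[OF y(1)])
    have xy: "x i \<otimes> y (n - i) \<in> F n" for i n by (rule F_mult[OF x(1) y(1)]) simp
    have fg: "(f \<otimes>\<^bsub>gr\<^esub> g) n = F (n - 1) +> (\<Oplus>i\<in>?T. x i \<otimes> y (n - i))" for n
      by (rule gr_mult_eval[OF x(1,2) y(1,2) gr_support_finite[OF f] x(3)]) simp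
    have l: "(c \<odot>\<^bsub>gr\<^esub> (f \<otimes>\<^bsub>gr\<^esub> g)) n = F (n - 1) +> (\<Oplus>i\<in>?T. c \<odot> (x i \<otimes> y (n - i)))" for n
    proof -
      have "(c \<odot>\<^bsub>gr\<^esub> (f \<otimes>\<^bsub>gr\<^esub> g)) n = F (n - 1) +> c \<odot> (\<Oplus>i\<in>?T. x i \<otimes> y (n - i))"
        by (intro gr_smult_eval[OF c _ fg] F_finsum Pi_I xy)
      also have "c \<odot> (\<Oplus>i\<in>?T. x i \<otimes> y (n - i)) = (\<Oplus>i\<in>?T. c \<odot> (x i \<otimes> y (n - i)))"
        by (intro finsum_smult_ldistr c x(3)) simp
      finally show ?thesis .
    qed
    have cf: "(c \<odot>\<^bsub>gr\<^esub> f) n = F (n - 1) +> c \<odot> x n" for n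
      by (rule gr_smult_eval[OF c x(1,2)])
    have cg: "(c \<odot>\<^bsub>gr\<^esub> g) n = F (n - 1) +> c \<odot> y n" for n
      by (rule gr_smult_eval[OF c y(1,2)])
    have "((c \<odot>\<^bsub>gr\<^esub> f) \<otimes>\<^bsub>gr\<^esub> g) n = F (n - 1) +> (\<Oplus>i\<in>?T. (c \<odot> x i) \<otimes> y (n - i))" for n
      by (rule gr_mult_eval[OF F_smult[OF c x(1)] cf y(1,2)
            gr_support_finite[OF gr_smult_carrier[OF c f]] x(3)]) (use c in simp)
    then show "c \<odot>\<^bsub>gr\<^esub> f \<otimes>\<^bsub>gr\<^esub> g = c \<odot>\<^bsub>gr\<^esub> (f \<otimes>\<^bsub>gr\<^esub> g)"
      using c by (simp add: fun_eq_iff l smult_mult_left)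
    have "(f \<otimes>\<^bsub>gr\<^esub> (c \<odot>\<^bsub>gr\<^esub> g)) n = F (n - 1) +> (\<Oplus>i\<in>?T. x i \<otimes> (c \<odot> y (n - i)))" for n
      by (rule gr_mult_eval[OF x(1,2) F_smult[OF c y(1)] cg
            gr_support_finite[OF f] x(3)]) simp
    then show "f \<otimes>\<^bsub>gr\<^esub> (c \<odot>\<^bsub>gr\<^esub> g) = c \<odot>\<^bsub>gr\<^esub> (f \<otimes>\<^bsub>gr\<^esub> g)"
      using c by (simp add: fun_eq_iff l smult_mult_right)
  qed
  then show ?thesis using gr_ring gr_module by (simp add: assoc_algebra_def)
qed

section \<open>Homogeneous elements and the grading\<close>

sublocale gr: assoc_algebra K gr
  by (rule gr_assoc_algebra)

text \<open>The principal symbol with prescribed degree: it vanishes when \<open>a\<close> already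
  lies in \<open>F (n - 1)\<close>, and this makes it additive on \<open>F n\<close>.\<close>

definition homog :: "int \<Rightarrow> 'c \<Rightarrow> int \<Rightarrow> 'c set" where
  "homog n a = (\<lambda>j. if j = n then F (n - 1) +> a else F (j - 1))"

definition homog_repr :: "int \<Rightarrow> 'c \<Rightarrow> int \<Rightarrow> 'c" where
  "homog_repr n a = (\<lambda>j. if j = n then a else \<zero>)"

lemma homog_repr_in_F: "a \<in> F n \<Longrightarrow> homog_repr n a j \<in> F j"
  by (simp add: homog_repr_def)

lemma homog_eval: "homog n a j = F (j - 1) +> homog_repr n a j"
  by (simp add: homog_def homog_repr_def F_carrier)

lemma homog_same [simp]: "homog n a n = F (n - 1) +> a"
  by (simp add: homog_def)

lemma homog_carrier [simp]:
  assumes "a \<in> F n" shows "homog n a \<in> carrier gr"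
proof (rule gr_carrierI)
  have "{i. homog_repr n a i \<notin> F (i - 1)} \<subseteq> {n}" by (auto simp: homog_repr_def)
  then show "finite {i. homog_repr n a i \<notin> F (i - 1)}" using finite_subset by blast
qed (simp_all add: homog_repr_in_F[OF assms] homog_eval)

lemma gr_component_eq: "gr_component A F n = homog n ` F n"
proof (intro subset_antisym subsetI)
  fix f assume f: "f \<in> gr_component A F n"
  then obtain a where "a \<in> F n" "f n = F (n - 1) +> a"
    unfolding gr_component_def gr_carrier_iff by blast
  moreover from this have "f = homog n a"
    using f by (simp add: gr_component_def homog_def fun_eq_iff)
  ultimately show "f \<in> homog n ` F n" by blast
qed (auto simp: gr_component_def, simp_all add: homog_def)

lemma homog_eq_iff: "a \<in> F n \<Longrightarrow> b \<in> F n \<Longrightarrow> homog n a = homog n b \<longleftrightarrow> a \<ominus> b \<in> F (n - 1)"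
  by (simp add: homog_def fun_eq_iff coset_eq_iff)

lemma homog_zero [simp]: "a \<in> F (n - 1) \<Longrightarrow> homog n a = \<zero>\<^bsub>gr\<^esub>"
  using coset_eq_F_iff[of a "n - 1"] F_in_carrier[of a "n - 1"] by (simp add: homog_def gr_zero fun_eq_iff)

lemma homog_one: "homog 0 \<one> = \<one>\<^bsub>gr\<^esub>"
  by (simp add: homog_def gr_one fun_eq_iff)

lemma homog_add:
  assumes "a \<in> F n" "b \<in> F n"
  shows "homog n (a \<oplus> b) = homog n a \<oplus>\<^bsub>gr\<^esub> homog n b"
proof
  fix j
  have "(homog n a \<oplus>\<^bsub>gr\<^esub> homog n b) j = F (j - 1) +> (homog_repr n a j \<oplus> homog_repr n b j)"
    by (rule gr_add_eval; intro homog_repr_in_F assms homog_eval)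
  also have "homog_repr n a j \<oplus> homog_repr n b j = homog_repr n (a \<oplus> b) j"
    by (simp add: homog_repr_def)
  finally show "homog n (a \<oplus> b) j = (homog n a \<oplus>\<^bsub>gr\<^esub> homog n b) j"
    by (simp only: homog_eval[of n "a \<oplus> b"])
qed

lemma homog_smult:
  assumes "c \<in> carrier K" "a \<in> F n"
  shows "homog n (c \<odot> a) = c \<odot>\<^bsub>gr\<^esub> homog n a"
proof
  fix j
  have "(c \<odot>\<^bsub>gr\<^esub> homog n a) j = F (j - 1) +> c \<odot> homog_repr n a j"
    by (rule gr_smult_eval; intro homog_repr_in_F assms homog_eval)
  also have "c \<odot> homog_repr n a j = homog_repr n (c \<odot> a) j"
    using assms by (simp add: homog_repr_def)
  finally show "homog n (c \<odot> a) j = (c \<odot>\<^bsub>gr\<^esub> homog n a) j"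
    by (simp only: homog_eval[of n "c \<odot> a"])
qed

lemma homog_mult_eval:
  assumes a: "a \<in> F i" and y: "\<And>j. y j \<in> F j" "\<And>j. g j = F (j - 1) +> y j"
  shows "(homog i a \<otimes>\<^bsub>gr\<^esub> g) n = F (n - 1) +> a \<otimes> y (n - i)"
proof -
  have "(homog i a \<otimes>\<^bsub>gr\<^esub> g) n = F (n - 1) +> (\<Oplus>j\<in>{i}. homog_repr i a j \<otimes> y (n - j))"
    by (rule gr_mult_eval[OF homog_repr_in_F[OF a] homog_eval y gr_support_finite[OF homog_carrier[OF a]]])
      (simp_all add: homog_repr_def)
  moreover have "a \<in> carrier A" "y (n - i) \<in> carrier A" using a F_in_carrier[OF y(1)] by auto
  ultimately show ?thesis by (simp add: homog_repr_def)
qed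

lemma mult_homog_eval:
  assumes g: "g \<in> carrier gr" and y: "\<And>j. y j \<in> F j" "\<And>j. g j = F (j - 1) +> y j" and a: "a \<in> F i"
  shows "(g \<otimes>\<^bsub>gr\<^esub> homog i a) n = F (n - 1) +> y (n - i) \<otimes> a"
proof -
  have "(g \<otimes>\<^bsub>gr\<^esub> homog i a) n = F (n - 1) +> (\<Oplus>j\<in>{n - i}. y j \<otimes> homog_repr i a (n - j))"
    by (rule gr_mult_eval[OF y homog_repr_in_F[OF a] homog_eval gr_support_finite[OF g]])
      (auto simp: homog_repr_def)
  moreover have "a \<in> carrier A" "y (n - i) \<in> carrier A" using a F_in_carrier[OF y(1)] by auto
  ultimately show ?thesis by (simp add: homog_repr_def)
qed

lemma homog_mult:
  assumes "a \<in> F i" "b \<in> F j"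
  shows "homog i a \<otimes>\<^bsub>gr\<^esub> homog j b = homog (i + j) (a \<otimes> b)"
proof
  fix n
  have "(homog i a \<otimes>\<^bsub>gr\<^esub> homog j b) n = F (n - 1) +> a \<otimes> homog_repr j b (n - i)"
    by (rule homog_mult_eval[OF assms(1) homog_repr_in_F[OF assms(2)] homog_eval])
  also have "a \<otimes> homog_repr j b (n - i) = homog_repr (i + j) (a \<otimes> b) n"
    using assms by (auto simp: homog_repr_def)
  finally show "(homog i a \<otimes>\<^bsub>gr\<^esub> homog j b) n = homog (i + j) (a \<otimes> b) n"
    by (simp only: homog_eval[of "i + j"])
qed

lemma gr_component_carrier: "gr_component A F n \<subseteq> carrier gr"
  by (auto simp: gr_component_def)

text \<open>Summands of other degrees contribute the trivial coset in degree \<open>j\<close>. This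
  yields existence as well as uniqueness of the homogeneous decomposition.\<close>

lemma gr_component_finsum:
  assumes "finite S" "\<And>i. h i \<in> gr_component A F i"
  shows "finsum gr h S j = (if j \<in> S then h j j else F (j - 1))"
  using assms(1)
proof (induction S rule: finite_induct)
  case empty
  then show ?case by (simp add: gr_zero)
next
  case (insert i S)
  interpret Qj: comm_group "Q j" by (rule Q_comm_group)
  have h: "h i \<in> carrier gr" for i using assms(2) gr_component_carrier by blast
  then have eq: "finsum gr h (insert i S) j = h i j <+>\<^bsub>A\<^esub> finsum gr h S j"
    using insert.hyps by (simp add: gr_add)
  have "h i j \<in> carrier (Q j)" "finsum gr h S j \<in> carrier (Q j)"
    using h[of i] gr.M.finsum_closed[of h S] h by (auto simp: gr_carrier_iff Q_carrier image_iff)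
  then have "F (j - 1) <+>\<^bsub>A\<^esub> finsum gr h S j = finsum gr h S j" "h i j <+>\<^bsub>A\<^esub> F (j - 1) = h i j"
    using Qj.l_one Qj.r_one by (simp_all add: Q_one Q_mult)
  moreover have "h i j = F (j - 1)" if "j \<noteq> i" using assms(2)[of i] that by (auto simp: gr_component_def)
  ultimately show ?case using insert eq by (cases "j = i") simp_all
qed

lemma gr_decomposition:
  assumes f: "f \<in> carrier gr"
  obtains h where "\<And>i. h i \<in> gr_component A F i" "finite {i. h i \<noteq> \<zero>\<^bsub>gr\<^esub>}"
    "f = finsum gr h {i. h i \<noteq> \<zero>\<^bsub>gr\<^esub>}"
proof -
  obtain x where x: "\<And>i. x i \<in> F i" "\<And>i. f i = F (i - 1) +> x i" "finite {i. x i \<noteq> \<zero>}"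
    using gr_repr[OF f] by metis
  define h where "h i = homog i (x i)" for i
  have h: "h i \<in> gr_component A F i" for i using x by (simp add: gr_component_eq h_def)
  have "{i. h i \<noteq> \<zero>\<^bsub>gr\<^esub>} \<subseteq> {i. x i \<noteq> \<zero>}" by (auto simp: h_def)
  with x have fin: "finite {i. h i \<noteq> \<zero>\<^bsub>gr\<^esub>}" using finite_subset by blast
  have "f j = finsum gr h {i. h i \<noteq> \<zero>\<^bsub>gr\<^esub>} j" for j
  proof -
    have "f j = h j j" by (simp add: h_def x(2)[of j])
    then show ?thesis using gr_component_finsum[OF fin h, of j] by (auto simp: gr_zero)
  qed
  with h fin show thesis by (intro that[of h]) auto
qed

lemma gr_component_submodule: "submodule (gr_component A F n) K gr"
proof (rule gr.submoduleI)
  show "\<zero>\<^bsub>gr\<^esub> \<in> gr_component A F n"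
    using homog_zero[of \<zero> n] by (auto simp: gr_component_eq image_iff intro!: bexI[of _ \<zero>])
  fix f assume f: "f \<in> gr_component A F n"
  then obtain a where a: "a \<in> F n" "f = homog n a" by (auto simp: gr_component_eq)
  show sm: "c \<odot>\<^bsub>gr\<^esub> f \<in> gr_component A F n" if "c \<in> carrier K" for c
    using a that homog_smult[of c a n] by (auto simp: gr_component_eq image_iff intro!: bexI[of _ "c \<odot> a"])
  have "\<ominus>\<^bsub>gr\<^esub> f = (\<ominus>\<^bsub>K\<^esub> \<one>\<^bsub>K\<^esub>) \<odot>\<^bsub>gr\<^esub> f"
    using gr.smult_l_minus[of "\<one>\<^bsub>K\<^esub>" f] a by simp
  then show "\<ominus>\<^bsub>gr\<^esub> f \<in> gr_component A F n" using sm by simp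
  fix g assume "g \<in> gr_component A F n"
  then obtain b where b: "b \<in> F n" "g = homog n b" by (auto simp: gr_component_eq)
  show "f \<oplus>\<^bsub>gr\<^esub> g \<in> gr_component A F n"
    using a b homog_add[of a n b] by (auto simp: gr_component_eq image_iff intro!: bexI[of _ "a \<oplus> b"])
qed (rule gr_component_carrier)

lemma gr_graded_algebra: "graded_algebra K gr (gr_component A F)"
proof (intro graded_algebra.intro graded_algebra_axioms.intro gr_assoc_algebra)
  fix i j show "submodule (gr_component A F i) K gr" by (rule gr_component_submodule)
  show "\<one>\<^bsub>gr\<^esub> \<in> gr_component A F 0" unfolding gr_component_eq homog_one[symmetric] by simp
  show "f \<otimes>\<^bsub>gr\<^esub> g \<in> gr_component A F (i + j)"
    if "f \<in> gr_component A F i" "g \<in> gr_component A F j" for f g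
    using that by (auto simp: gr_component_eq homog_mult filtration_mult)
next
  fix b assume b: "b \<in> carrier gr"
  obtain h where h: "\<And>i. h i \<in> gr_component A F i" "finite {i. h i \<noteq> \<zero>\<^bsub>gr\<^esub>}"
    "b = finsum gr h {i. h i \<noteq> \<zero>\<^bsub>gr\<^esub>}"
    using gr_decomposition[OF b] by metis
  \<comment> \<open>The right-hand side depends on \<open>b\<close> alone, so any two decompositions
    coincide.\<close>
  have unique: "g j = (\<lambda>k. if k = j then b j else F (k - 1))"
    if g: "\<And>i. g i \<in> gr_component A F i" "finite {i. g i \<noteq> \<zero>\<^bsub>gr\<^esub>}"
      "b = finsum gr g {i. g i \<noteq> \<zero>\<^bsub>gr\<^esub>}" for g j
  proof -
    have "b j = g j j"
      using gr_component_finsum[OF g(2,1), of j] g(3) by (auto simp: gr_zero)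
    then show ?thesis using g(1)[of j] by (simp add: gr_component_def fun_eq_iff)
  qed
  show "\<exists>!f. (\<forall>i. f i \<in> gr_component A F i) \<and> finite {i. f i \<noteq> \<zero>\<^bsub>gr\<^esub>} \<and>
      b = finsum gr f {i. f i \<noteq> \<zero>\<^bsub>gr\<^esub>}"
  proof (rule ex1I[of _ h])
    show "(\<forall>i. h i \<in> gr_component A F i) \<and> finite {i. h i \<noteq> \<zero>\<^bsub>gr\<^esub>} \<and>
      b = finsum gr h {i. h i \<noteq> \<zero>\<^bsub>gr\<^esub>}" using h by blast
    fix g assume "(\<forall>i. g i \<in> gr_component A F i) \<and> finite {i. g i \<noteq> \<zero>\<^bsub>gr\<^esub>} \<and>
      b = finsum gr g {i. g i \<noteq> \<zero>\<^bsub>gr\<^esub>}"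
    then have "g j = h j" for j
      using unique[of g j] unique[OF h, of j] by (elim conjE) (simp only:)
    then show "g = h" by (rule ext)
  qed
qed

end

section \<open>Filtrations by weighted generators\<close>

locale unital_algebra = assoc_algebra K A for K and A (structure)
begin

text \<open>The carrier condition in \<open>base\<close> makes the span of any set a submodule. The
  inductive form gives the principle "check it on words and extend linearly".\<close>

inductive_set linear_span :: "'c set \<Rightarrow> 'c set" for S where
  zero: "\<zero> \<in> linear_span S"
| base: "s \<in> S \<Longrightarrow> s \<in> carrier A \<Longrightarrow> s \<in> linear_span S"
| add: "x \<in> linear_span S \<Longrightarrow> y \<in> linear_span S \<Longrightarrow> x \<oplus> y \<in> linear_span S"
| smult: "c \<in> carrier K \<Longrightarrow> x \<in> linear_span S \<Longrightarrow> c \<odot> x \<in> linear_span S"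

lemma span_carrier: "x \<in> linear_span S \<Longrightarrow> x \<in> carrier A"
  by (induction rule: linear_span.induct) auto

lemma span_submodule: "submodule (linear_span S) K A"
proof (rule submoduleI)
  fix x assume x: "x \<in> linear_span S"
  have "\<ominus> x = (\<ominus>\<^bsub>K\<^esub> \<one>\<^bsub>K\<^esub>) \<odot> x"
    using smult_l_minus[of "\<one>\<^bsub>K\<^esub>" x] span_carrier[OF x] by simp
  then show "\<ominus> x \<in> linear_span S" using linear_span.smult[OF _ x, of "\<ominus>\<^bsub>K\<^esub> \<one>\<^bsub>K\<^esub>"] by simp
qed (auto intro: linear_span.intros span_carrier)

lemma span_minus: "x \<in> linear_span S \<Longrightarrow> y \<in> linear_span S \<Longrightarrow> x \<ominus> y \<in> linear_span S"
  unfolding a_minus_def using submoduleE(3)[OF span_submodule] linear_span.add by blast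

lemma span_induct_submodule:
  assumes "submodule N K A" "x \<in> linear_span S" "\<And>s. s \<in> S \<Longrightarrow> s \<in> carrier A \<Longrightarrow> s \<in> N"
  shows "x \<in> N"
  using assms(2) submoduleE[OF assms(1)] assms(3) submodule.axioms(1)[OF assms(1), THEN subgroup.one_closed]
  by (induction rule: linear_span.induct) auto

lemma span_mono: "S \<subseteq> T \<Longrightarrow> linear_span S \<subseteq> linear_span T"
  using span_induct_submodule[OF span_submodule] linear_span.base by blast

lemma span_mult:
  assumes "\<And>s t. s \<in> S \<Longrightarrow> t \<in> T \<Longrightarrow> s \<in> carrier A \<Longrightarrow> t \<in> carrier A \<Longrightarrow> s \<otimes> t \<in> linear_span U"
    and "x \<in> linear_span S" "y \<in> linear_span T"
  shows "x \<otimes> y \<in> linear_span U"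
  using assms(2)
proof (induction rule: linear_span.induct)
  case (base s)
  from assms(3) show ?case
  proof (induction rule: linear_span.induct)
    case (add y z)
    then show ?case using base span_carrier linear_span.add by (simp add: r_distr)
  next
    case (smult c y)
    then show ?case using base span_carrier linear_span.smult by (simp add: smult_mult_right)
  qed (use base assms(1) linear_span.zero in auto)
next
  case (add x z)
  then show ?case using span_carrier assms(3) linear_span.add by (simp add: l_distr)
next
  case (smult c x)
  then show ?case using span_carrier assms(3) linear_span.smult by (simp add: smult_mult_left)
qed (use span_carrier[OF assms(3)] linear_span.zero in simp)

text \<open>The bracket with a fixed \<open>x\<close> is linear, so the preimage of a submodule is a
  submodule. Together with \<open>span_induct_submodule\<close> this reduces commutator estimates to
  spanning elements.\<close>

lemma commutator_submodule_right:
  assumes "submodule N K A" "x \<in> carrier A"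
  shows "submodule {y \<in> carrier A. x \<otimes> y \<ominus> y \<otimes> x \<in> N} K A"
proof (rule submoduleI)
  note N = submoduleE[OF assms(1)]
  have N0: "\<zero> \<in> N" using subgroup.one_closed[OF submodule.axioms(1)[OF assms(1)]] by simp
  then show "\<zero> \<in> {y \<in> carrier A. x \<otimes> y \<ominus> y \<otimes> x \<in> N}" using assms by (simp add: a_minus_def)
  fix y assume "y \<in> {y \<in> carrier A. x \<otimes> y \<ominus> y \<otimes> x \<in> N}"
  then have y: "y \<in> carrier A" "x \<otimes> y \<ominus> y \<otimes> x \<in> N" by auto
  have "x \<otimes> (\<ominus> y) \<ominus> (\<ominus> y) \<otimes> x = \<ominus> (x \<otimes> y \<ominus> y \<otimes> x)"
    using assms y by (simp add: a_minus_def l_minus r_minus M.minus_add)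
  then show "\<ominus> y \<in> {y \<in> carrier A. x \<otimes> y \<ominus> y \<otimes> x \<in> N}" using N(3)[OF y(2)] y by simp
  show "c \<odot> y \<in> {y \<in> carrier A. x \<otimes> y \<ominus> y \<otimes> x \<in> N}" if c: "c \<in> carrier K" for c
  proof -
    have "x \<otimes> (c \<odot> y) \<ominus> (c \<odot> y) \<otimes> x = c \<odot> (x \<otimes> y \<ominus> y \<otimes> x)"
      using assms y c
      by (simp add: a_minus_def smult_mult_left smult_mult_right smult_r_distr smult_r_minus)
    then show ?thesis using N(4)[OF c y(2)] y c by simp
  qed
  fix z assume "z \<in> {y \<in> carrier A. x \<otimes> y \<ominus> y \<otimes> x \<in> N}"
  then have z: "z \<in> carrier A" "x \<otimes> z \<ominus> z \<otimes> x \<in> N" by auto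
  have "x \<otimes> (y \<oplus> z) \<ominus> (y \<oplus> z) \<otimes> x = (x \<otimes> y \<ominus> y \<otimes> x) \<oplus> (x \<otimes> z \<ominus> z \<otimes> x)"
    using assms y z by (simp add: a_minus_def l_distr r_distr M.minus_add M.a_ac)
  then show "y \<oplus> z \<in> {y \<in> carrier A. x \<otimes> y \<ominus> y \<otimes> x \<in> N}" using N(5)[OF y(2) z(2)] y z by simp
qed auto

lemma commutator_swap:
  assumes "submodule N K A" "x \<in> carrier A" "y \<in> carrier A" "x \<otimes> y \<ominus> y \<otimes> x \<in> N"
  shows "y \<otimes> x \<ominus> x \<otimes> y \<in> N"
proof -
  have "y \<otimes> x \<ominus> x \<otimes> y = \<ominus> (x \<otimes> y \<ominus> y \<otimes> x)"
    using assms by (simp add: a_minus_def M.minus_add M.a_ac)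
  with submoduleE(3)[OF assms(1,4)] show ?thesis by simp
qed

section \<open>Words in weighted letters\<close>

fun val :: "('c \<times> nat) list \<Rightarrow> 'c" where
  "val [] = \<one>"
| "val (x # u) = fst x \<otimes> val u"

text \<open>Weight belongs to the word and not to its value: one element of \<open>A\<close> may be
  the value of words of different weights, and may even be a letter with several weights.\<close>

definition weight :: "('c \<times> nat) list \<Rightarrow> nat" where
  "weight u = sum_list (map snd u)"

lemma weight_simps [simp]: "weight [] = 0" "weight (x # u) = snd x + weight u" "weight (u @ v) = weight u + weight v"
  by (simp_all add: weight_def)

lemma val_closed: "u \<in> lists E \<Longrightarrow> fst ` E \<subseteq> carrier A \<Longrightarrow> val u \<in> carrier A"
  by (induction u) auto

lemma val_append:
  "u \<in> lists E \<Longrightarrow> v \<in> lists E \<Longrightarrow> fst ` E \<subseteq> carrier A \<Longrightarrow> val (u @ v) = val u \<otimes> val v"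
proof (induction u)
  case (Cons x u)
  then show ?case using val_closed[of u E] val_closed[of v E] m_assoc[of "fst x" "val u" "val v"] by auto
qed (simp add: val_closed)

definition weight_filtration :: "('c \<times> nat) set \<Rightarrow> int \<Rightarrow> 'c set" where
  "weight_filtration E n = linear_span (val ` {u \<in> lists E. int (weight u) \<le> n})"

end

text \<open>All that the weight filtration needs, without reference to \<open>F\<close>. Positive
  weights on finitely many letters give connectedness and finite dimensional components; the
  commutator bound on letters gives commutativity.\<close>

locale weighted_generators = unital_algebra K A for K and A (structure) +
  fixes E :: "('c \<times> nat) set"
  assumes E_finite: "finite E"
    and E_carrier: "fst ` E \<subseteq> carrier A"
    and E_pos: "x \<in> E \<Longrightarrow> 0 < snd x"
    and E_generate: "linear_span (val ` lists E) = carrier A"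
    and E_commutator: "x \<in> E \<Longrightarrow> y \<in> E \<Longrightarrow>
      fst x \<otimes> fst y \<ominus> fst y \<otimes> fst x \<in> weight_filtration E (int (snd x) + int (snd y) - 1)"
begin

section \<open>The weight filtration and its commutators\<close>

abbreviation G where "G \<equiv> weight_filtration E"

lemma G_submodule: "submodule (G n) K A"
  unfolding weight_filtration_def by (rule span_submodule)

lemma G_carrier: "x \<in> G n \<Longrightarrow> x \<in> carrier A"
  unfolding weight_filtration_def by (rule span_carrier)

lemma G_add: "x \<in> G n \<Longrightarrow> y \<in> G n \<Longrightarrow> x \<oplus> y \<in> G n"
  unfolding weight_filtration_def by (rule linear_span.add)

lemma G_mono: "m \<le> n \<Longrightarrow> G m \<subseteq> G n"
  unfolding weight_filtration_def by (rule span_mono) auto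

lemma word_in_G: "u \<in> lists E \<Longrightarrow> int (weight u) \<le> n \<Longrightarrow> val u \<in> G n"
  unfolding weight_filtration_def by (rule linear_span.base) (simp_all add: val_closed[OF _ E_carrier])

lemma G_mult:
  assumes "x \<in> G i" "y \<in> G j" shows "x \<otimes> y \<in> G (i + j)"
  unfolding weight_filtration_def
proof (rule span_mult[OF _ assms[unfolded weight_filtration_def]])
  fix s t
  assume "s \<in> val ` {u \<in> lists E. int (weight u) \<le> i}" "t \<in> val ` {u \<in> lists E. int (weight u) \<le> j}"
  then obtain u v where uv: "u \<in> lists E" "v \<in> lists E" "int (weight u) \<le> i" "int (weight v) \<le> j"
    "s = val u" "t = val v" by auto
  then have "val (u @ v) \<in> G (i + j)" by (intro word_in_G) auto
  then show "s \<otimes> t \<in> linear_span (val ` {u \<in> lists E. int (weight u) \<le> i + j})"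
    using uv E_carrier by (simp add: weight_filtration_def val_append)
qed

lemma G_negative: "n < 0 \<Longrightarrow> G n = {\<zero>}"
proof -
  assume "n < 0"
  then have *: "{u \<in> lists E. int (weight u) \<le> n} = {}" by auto
  have "x = \<zero>" if "x \<in> linear_span {}" for x using that by (induction rule: linear_span.induct) auto
  then show ?thesis unfolding weight_filtration_def * using linear_span.zero by auto
qed

lemma generator_in_G: "x \<in> E \<Longrightarrow> fst x \<in> G (int (snd x))"
  using word_in_G[of "[x]" "int (snd x)"] E_carrier by auto

text \<open>The Leibniz rule \<open>[a, b c] = [a, b] c + b [a, c]\<close>: each summand contains
  one bracket, and that bracket already loses one unit of weight.\<close>

lemma generator_word_commutator:
  assumes x: "x \<in> E" and u: "u \<in> lists E"
  shows "fst x \<otimes> val u \<ominus> val u \<otimes> fst x \<in> G (int (snd x) + int (weight u) - 1)"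
  using u
proof (induction u)
  case Nil
  then show ?case
    using x E_carrier linear_span.zero by (auto simp: weight_filtration_def a_minus_def M.r_neg)
next
  case (Cons y u)
  let ?a = "fst x" and ?b = "fst y" and ?c = "val u"
  have c: "?a \<in> carrier A" "?b \<in> carrier A" "?c \<in> carrier A"
    using x Cons E_carrier val_closed[of u E] by auto
  have "(?a \<otimes> ?b \<ominus> ?b \<otimes> ?a) \<otimes> ?c \<in> G (int (snd x) + int (snd y) - 1 + int (weight u))"
    using x Cons by (intro G_mult E_commutator word_in_G) auto
  moreover have "?b \<otimes> (?a \<otimes> ?c \<ominus> ?c \<otimes> ?a) \<in> G (int (snd y) + (int (snd x) + int (weight u) - 1))"
    using Cons by (intro G_mult generator_in_G) auto
  ultimately have "(?a \<otimes> ?b \<ominus> ?b \<otimes> ?a) \<otimes> ?c \<oplus> ?b \<otimes> (?a \<otimes> ?c \<ominus> ?c \<otimes> ?a)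
      \<in> G (int (snd x) + int (weight (y # u)) - 1)"
    by (intro G_add) (simp_all add: algebra_simps)
  also have "(?a \<otimes> ?b \<ominus> ?b \<otimes> ?a) \<otimes> ?c \<oplus> ?b \<otimes> (?a \<otimes> ?c \<ominus> ?c \<otimes> ?a)
      = ?a \<otimes> val (y # u) \<ominus> val (y # u) \<otimes> ?a"
    using c by (simp add: a_minus_def l_distr r_distr l_minus r_minus m_assoc M.a_ac M.r_neg1 M.r_neg2)
  finally show ?case .
qed

text \<open>The Leibniz rule in the other argument,
  \<open>[a b, c] = a [b, c] + [a, c] b\<close>.\<close>

lemma word_commutator:
  assumes u: "u \<in> lists E" and v: "v \<in> lists E"
  shows "val u \<otimes> val v \<ominus> val v \<otimes> val u \<in> G (int (weight u) + int (weight v) - 1)"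
  using u
proof (induction u)
  case Nil
  then show ?case using val_closed[OF v E_carrier] linear_span.zero
    by (auto simp: weight_filtration_def a_minus_def M.r_neg)
next
  case (Cons x u)
  let ?a = "fst x" and ?b = "val u" and ?c = "val v"
  have c: "?a \<in> carrier A" "?b \<in> carrier A" "?c \<in> carrier A"
    using v Cons E_carrier val_closed[of u E] val_closed[of v E] by auto
  have "?a \<otimes> (?b \<otimes> ?c \<ominus> ?c \<otimes> ?b) \<in> G (int (snd x) + (int (weight u) + int (weight v) - 1))"
    using Cons by (intro G_mult generator_in_G) auto
  moreover have "(?a \<otimes> ?c \<ominus> ?c \<otimes> ?a) \<otimes> ?b \<in> G (int (snd x) + int (weight v) - 1 + int (weight u))"
    using v Cons by (intro G_mult generator_word_commutator word_in_G) auto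
  ultimately have "?a \<otimes> (?b \<otimes> ?c \<ominus> ?c \<otimes> ?b) \<oplus> (?a \<otimes> ?c \<ominus> ?c \<otimes> ?a) \<otimes> ?b
      \<in> G (int (weight (x # u)) + int (weight v) - 1)"
    by (intro G_add) (simp_all add: algebra_simps)
  also have "?a \<otimes> (?b \<otimes> ?c \<ominus> ?c \<otimes> ?b) \<oplus> (?a \<otimes> ?c \<ominus> ?c \<otimes> ?a) \<otimes> ?b
      = val (x # u) \<otimes> ?c \<ominus> ?c \<otimes> val (x # u)"
    using c by (simp add: a_minus_def l_distr r_distr l_minus r_minus m_assoc M.a_ac M.r_neg1 M.r_neg2)
  finally show ?case .
qed

lemma G_commutator:
  assumes x: "x \<in> G i" and y: "y \<in> G j"
  shows "x \<otimes> y \<ominus> y \<otimes> x \<in> G (i + j - 1)"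
proof -
  have word: "val u \<otimes> y \<ominus> y \<otimes> val u \<in> G (i + j - 1)" if u: "u \<in> lists E" "int (weight u) \<le> i" for u
  proof -
    have "y \<in> {y \<in> carrier A. val u \<otimes> y \<ominus> y \<otimes> val u \<in> G (i + j - 1)}"
    proof (rule span_induct_submodule[OF commutator_submodule_right y[unfolded weight_filtration_def]])
      fix s assume s: "s \<in> val ` {u \<in> lists E. int (weight u) \<le> j}" "s \<in> carrier A"
      then obtain v where v: "v \<in> lists E" "int (weight v) \<le> j" "s = val v" by auto
      then have "G (int (weight u) + int (weight v) - 1) \<subseteq> G (i + j - 1)" using u by (intro G_mono) auto
      then show "s \<in> {y \<in> carrier A. val u \<otimes> y \<ominus> y \<otimes> val u \<in> G (i + j - 1)}"
        using word_commutator[OF u(1) v(1)] s v by auto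
    qed (use G_submodule val_closed[OF u(1) E_carrier] in auto)
    then show ?thesis by simp
  qed
  \<comment> \<open>\<open>commutator_submodule_right\<close> keeps the left entry fixed, so the
    induction on \<open>x\<close> runs on the reversed commutator.\<close>
  have "x \<in> {x \<in> carrier A. y \<otimes> x \<ominus> x \<otimes> y \<in> G (i + j - 1)}"
  proof (rule span_induct_submodule[OF commutator_submodule_right x[unfolded weight_filtration_def]])
    fix s assume s: "s \<in> val ` {u \<in> lists E. int (weight u) \<le> i}" "s \<in> carrier A"
    then show "s \<in> {x \<in> carrier A. y \<otimes> x \<ominus> x \<otimes> y \<in> G (i + j - 1)}"
      using word G_carrier[OF y] commutator_swap[OF G_submodule] by auto
  qed (use G_submodule G_carrier[OF y] in auto)
  then show ?thesis using G_carrier[OF y] commutator_swap[OF G_submodule] by auto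
qed

lemma G_nonnegative_filtered: "nonnegative_filtered_algebra K A G"
proof (intro nonnegative_filtered_algebra.intro algebra_filtration.intro
    algebra_filtration_axioms.intro nonnegative_filtered_algebra_axioms.intro assoc_algebra_axioms)
  show "\<one> \<in> G 0" using word_in_G[of "[]" 0] by simp
  show "G i \<subseteq> G (i + 1)" for i by (rule G_mono) simp
qed (simp_all add: G_submodule G_mult G_negative)

lemma G_exhaustive: "exhaustive_filtration A G"
proof -
  have "\<exists>n. x \<in> G n" if "x \<in> linear_span (val ` lists E)" for x
    using that
  proof (induction rule: linear_span.induct)
    case zero
    show ?case unfolding weight_filtration_def using linear_span.zero by auto
  next
    case (base s)
    then show ?case using word_in_G by force
  next
    case (add x y)
    then obtain m n where "x \<in> G m" "y \<in> G n" by auto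
    then have "x \<in> G (max m n)" "y \<in> G (max m n)" using G_mono by (meson max.cobounded1 max.cobounded2 subsetD)+
    then show ?case using G_add by auto
  next
    case (smult c x)
    then show ?case unfolding weight_filtration_def using linear_span.smult by auto
  qed
  then show ?thesis using E_generate G_carrier by (auto simp: exhaustive_filtration_def)
qed

end

sublocale nonnegative_filtered_algebra \<subseteq> unital_algebra K A
  by unfold_locales

sublocale weighted_generators \<subseteq> GF: nonnegative_filtered_algebra K A G
  by (rule G_nonnegative_filtered)

section \<open>The associated graded algebra of the weight filtration\<close>

context weighted_generators
begin

abbreviation grG where "grG \<equiv> assoc_graded A G"

lemma grG_commute:
  assumes f: "f \<in> carrier grG" and g: "g \<in> carrier grG"
  shows "f \<otimes>\<^bsub>grG\<^esub> g = g \<otimes>\<^bsub>grG\<^esub> f"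
proof
  fix n
  obtain x where x: "\<And>i. x i \<in> G i" "\<And>i. f i = G (i - 1) +> x i" "finite {i. x i \<noteq> \<zero>}"
    using GF.gr_repr[OF f] by metis
  obtain y where y: "\<And>i. y i \<in> G i" "\<And>i. g i = G (i - 1) +> y i" "finite {i. y i \<noteq> \<zero>}"
    using GF.gr_repr[OF g] by metis
  interpret Qn: comm_group "gr_quotient A G n" by (rule GF.Q_comm_group)
  let ?T = "{i. x i \<noteq> \<zero>}"
  have [simp]: "x i \<in> carrier A" "y i \<in> carrier A" for i
    by (rule G_carrier[OF x(1)], rule G_carrier[OF y(1)])
  have xy: "x i \<otimes> y (n - i) \<in> G n" and yx: "y (n - i) \<otimes> x i \<in> G n" for i
    by (rule GF.F_mult[OF x(1) y(1)], simp, rule GF.F_mult[OF y(1) x(1)], simp)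
  have "(f \<otimes>\<^bsub>grG\<^esub> g) n = G (n - 1) +> (\<Oplus>i\<in>?T. x i \<otimes> y (n - i))"
    by (rule GF.gr_mult_eval[OF x(1,2) y(1,2) GF.gr_support_finite[OF f] x(3)]) simp
  \<comment> \<open>The terms agree only modulo \<open>G (n - 1)\<close>, so factors are exchanged
    in a sum of cosets and not in \<open>A\<close>.\<close>
  also have "\<dots> = finprod (gr_quotient A G n) (\<lambda>i. G (n - 1) +> x i \<otimes> y (n - i)) ?T"
    using xy by (intro GF.finprod_Q_coset[symmetric]) auto
  also have "\<dots> = finprod (gr_quotient A G n) (\<lambda>i. G (n - 1) +> y (n - i) \<otimes> x i) ?T"
  proof (rule Qn.finprod_cong')
    fix i
    have "x i \<otimes> y (n - i) \<ominus> y (n - i) \<otimes> x i \<in> G (n - 1)"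
      using G_commutator[OF x(1)[of i] y(1)[of "n - i"]] by simp
    then show "G (n - 1) +> x i \<otimes> y (n - i) = G (n - 1) +> y (n - i) \<otimes> x i"
      by (simp add: GF.coset_eq_iff)
  qed (use yx in \<open>auto simp: GF.Q_carrier\<close>)
  also have "\<dots> = G (n - 1) +> (\<Oplus>i\<in>?T. y (n - i) \<otimes> x i)"
    using yx by (intro GF.finprod_Q_coset) auto
  \<comment> \<open>Reflecting the support of \<open>x\<close> gives an index set for the product
    \<open>g f\<close>. It need not be the support of \<open>y\<close>; it is enough that
    \<open>x (n - j)\<close> vanishes outside it.\<close>
  also have "(\<Oplus>i\<in>?T. y (n - i) \<otimes> x i) = (\<Oplus>j\<in>(\<lambda>i. n - i) ` ?T. y j \<otimes> x (n - j))"
    by (subst M.add.finprod_reindex) (auto simp: inj_on_def)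
  also have "G (n - 1) +> \<dots> = (g \<otimes>\<^bsub>grG\<^esub> f) n"
  proof (rule GF.gr_mult_eval[OF y(1,2) x(1,2) GF.gr_support_finite[OF g], symmetric])
    fix j assume "j \<notin> (\<lambda>i. n - i) ` ?T"
    then have "n - j \<notin> ?T" by (metis diff_diff_eq2 add_diff_cancel_left' image_eqI)
    then show "y j \<in> G (j - 1) \<or> x (n - j) \<in> G (n - j - 1)" by simp
  qed (use x(3) in simp)
  finally show "(f \<otimes>\<^bsub>grG\<^esub> g) n = (g \<otimes>\<^bsub>grG\<^esub> f) n" .
qed

lemma grG_cring: "cring grG"
  using GF.gr_ring grG_commute
  by (intro cring.intro monoid.monoid_comm_monoidI) (auto simp: ring_def)

text \<open>\<open>B\<close> shares only addition and zero with \<open>grG\<close>, so that the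
  lemma applies to \<open>grG\<close> itself and to a single component taken as a module.\<close>

lemma homog_in_submodule:
  assumes N: "subgroup N (add_monoid B)" "\<And>c f. c \<in> carrier K \<Longrightarrow> f \<in> N \<Longrightarrow> c \<odot>\<^bsub>grG\<^esub> f \<in> N"
    and B: "ring.add B = ring.add grG" "ring.zero B = ring.zero grG"
    and word: "\<And>u. u \<in> lists E \<Longrightarrow> int (weight u) \<le> n \<Longrightarrow> GF.homog n (val u) \<in> N"
    and a: "a \<in> G n"
  shows "GF.homog n a \<in> N"
proof -
  \<comment> \<open>Membership in \<open>G n\<close> is carried along because \<open>homog\<close>
    is linear only there.\<close>
  have "GF.homog n a \<in> N \<and> a \<in> G n"
    using a[unfolded weight_filtration_def]
  proof (induction rule: linear_span.induct)
    case zero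
    then show ?case using subgroup.one_closed[OF N(1)] B by simp
  next
    case (base s)
    then show ?case using word word_in_G by auto
  next
    case (add x y)
    then show ?case using subgroup.m_closed[OF N(1)] B by (simp add: GF.homog_add)
  next
    case (smult c x)
    then show ?case using N(2) by (simp add: GF.homog_smult)
  qed
  then show ?thesis ..
qed

text \<open>The symbols of the letters generate: in degree \<open>n\<close>, a word of weight
  exactly \<open>n\<close> has the product of the symbols of its letters as symbol, and a word of
  smaller weight has symbol zero.\<close>

lemma grG_finitely_generated: "finitely_generated_algebra K grG"
proof -
  let ?S = "(\<lambda>x. GF.homog (int (snd x)) (fst x)) ` E"
  have S: "finite ?S" "?S \<subseteq> carrier grG"
    using E_finite generator_in_G by auto
  have "carrier grG \<subseteq> N" if N: "submodule N K grG" "subring N grG" "?S \<subseteq> N" for N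
  proof
    have word: "GF.homog (int (weight u)) (val u) \<in> N" if "u \<in> lists E" for u
      using that
    proof (induction u)
      case Nil
      then show ?case using subringE(3)[OF N(2)] by (simp add: GF.homog_one)
    next
      case (Cons x u)
      then have "GF.homog (int (snd x)) (fst x) \<otimes>\<^bsub>grG\<^esub> GF.homog (int (weight u)) (val u) \<in> N"
        using N(3) by (intro subringE(6)[OF N(2)]) auto
      with Cons show ?case by (simp add: GF.homog_mult generator_in_G word_in_G)
    qed
    have homog: "GF.homog n a \<in> N" if a: "a \<in> G n" for n a
    proof (rule homog_in_submodule[OF submodule.axioms(1)[OF N(1)] _ refl refl _ a])
      fix u assume u: "u \<in> lists E" "int (weight u) \<le> n"
      show "GF.homog n (val u) \<in> N"
      proof (cases "int (weight u) = n")
        case False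
        then have "val u \<in> G (n - 1)" using u by (intro word_in_G) auto
        then show ?thesis using subringE(2)[OF N(2)] by simp
      qed (use word[OF u(1)] in auto)
    qed (rule submodule.smult_closed[OF N(1)])
    fix f assume "f \<in> carrier grG"
    then obtain h where h: "\<And>i. h i \<in> gr_component A G i" "finite {i. h i \<noteq> \<zero>\<^bsub>grG\<^esub>}"
      "f = finsum grG h {i. h i \<noteq> \<zero>\<^bsub>grG\<^esub>}" using GF.gr_decomposition by metis
    have hN: "h i \<in> N" for i using h(1)[of i] homog by (auto simp: GF.gr_component_eq)
    have "finsum grG h J \<in> N" if "finite J" for J
      using that
    proof (induction J rule: finite_induct)
      case empty
      then show ?case using subringE(2)[OF N(2)] by simp
    next
      case (insert i J)
      have "h i \<in> carrier grG" for i using hN subringE(1)[OF N(2)] by blast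
      with insert show ?case using subringE(7)[OF N(2)] hN by simp
    qed
    then show "f \<in> N" using h by simp
  qed
  moreover have "submodule (carrier grG) K grG \<and> subring (carrier grG) grG"
    using GF.gr.carrier_is_submodule GF.gr.carrier_is_subring by simp
  ultimately have "(\<lambda>N. submodule N K grG \<and> subring N grG) hull ?S = carrier grG"
    using S(2) by (intro hull_unique) auto
  with S show ?thesis unfolding finitely_generated_algebra_def by blast
qed

text \<open>Positive weights bound the length of a word by its weight.\<close>

lemma finite_words: "finite {u \<in> lists E. int (weight u) \<le> n}"
proof -
  have "length u \<le> weight u" if "u \<in> lists E" for u
    using that by (induction u) (auto dest: E_pos)
  then have "{u \<in> lists E. int (weight u) \<le> n} \<subseteq> {u. set u \<subseteq> E \<and> length u \<le> nat n}"
    by force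
  then show ?thesis using finite_lists_length_le[OF E_finite] finite_subset by blast
qed

text \<open>Only the empty word has weight zero.\<close>

lemma G_zero: assumes "a \<in> G 0" shows "\<exists>c\<in>carrier K. a = c \<odot> \<one>"
proof -
  have words: "u = []" if "u \<in> lists E" "int (weight u) \<le> 0" for u
    using that by (cases u) (auto dest: E_pos)
  show ?thesis
    using assms[unfolded weight_filtration_def]
  proof (induction rule: linear_span.induct)
    case zero
    then show ?case by (intro bexI[of _ "\<zero>\<^bsub>K\<^esub>"]) auto
  next
    case (base s)
    then obtain u where "u \<in> lists E" "int (weight u) \<le> 0" "s = val u" by auto
    with words[of u] show ?case by (intro bexI[of _ "\<one>\<^bsub>K\<^esub>"]) auto
  next
    case (add x y)
    then obtain c d where "c \<in> carrier K" "d \<in> carrier K" "x = c \<odot> \<one>" "y = d \<odot> \<one>" by auto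
    then show ?case by (intro bexI[of _ "c \<oplus>\<^bsub>K\<^esub> d"]) (auto simp: smult_l_distr)
  next
    case (smult c x)
    then obtain d where "d \<in> carrier K" "x = d \<odot> \<one>" by auto
    with smult show ?case by (intro bexI[of _ "c \<otimes>\<^bsub>K\<^esub> d"]) (auto simp: smult_assoc1)
  qed
qed

lemma grG_component_finite_dim:
  "finitely_generated_module K (grG\<lparr>carrier := gr_component A G n\<rparr>)"
proof -
  let ?C = "gr_component A G n" and ?S = "GF.homog n ` val ` {u \<in> lists E. int (weight u) \<le> n}"
  let ?M = "grG\<lparr>carrier := ?C\<rparr>"
  interpret C: module K ?M
    by (rule submodule.submodule_is_module[OF GF.gr_component_submodule GF.gr.module_axioms])
  have S: "?S \<subseteq> ?C" using word_in_G by (auto simp: GF.gr_component_eq)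
  have "?C \<subseteq> N" if N: "submodule N K ?M" "?S \<subseteq> N" for N
  proof
    fix f assume "f \<in> ?C"
    then obtain a where a: "a \<in> G n" "f = GF.homog n a" by (auto simp: GF.gr_component_eq)
    have "GF.homog n a \<in> N"
      by (rule homog_in_submodule[OF submodule.axioms(1)[OF N(1)] _ _ _ _ a(1)])
        (use N(2) submodule.smult_closed[OF N(1)] in auto)
    with a show "f \<in> N" by simp
  qed
  moreover have "submodule ?C K ?M" using C.carrier_is_submodule by simp
  ultimately have "(\<lambda>N. submodule N K ?M) hull ?S = carrier ?M"
    using S by (intro hull_unique) auto
  moreover have "finite ?S" using finite_words by blast
  ultimately show ?thesis using S unfolding finitely_generated_module_def by (intro exI[of _ ?S]) simp
qed

text \<open>Degree zero consists of scalars by \<open>G_zero\<close>. Since \<open>G (- 1)\<close>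
  is zero, scalars with equal classes have equal multiples of \<open>\<one>\<close>; a nonzero
  difference could be inverted and would force \<open>\<one> = \<zero>\<close> in
  \<open>A\<close>.\<close>

lemma grG_connected:
  assumes "field K" "\<one> \<noteq> \<zero>"
  shows "connected_graded_algebra K grG (gr_component A G)"
proof (intro connected_graded_algebra.intro connected_graded_algebra_axioms.intro
    GF.gr_graded_algebra assms grG_component_finite_dim)
  interpret K: field K by (rule assms)
  show "gr_component A G i = {\<zero>\<^bsub>grG\<^esub>}" if "i < 0" for i
    using that by (auto simp: GF.gr_component_eq G_negative)
  have homog: "c \<odot>\<^bsub>grG\<^esub> \<one>\<^bsub>grG\<^esub> = GF.homog 0 (c \<odot> \<one>)" if "c \<in> carrier K" for c
    using that by (simp add: GF.homog_smult GF.F_one GF.homog_one)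
  show "bij_betw (\<lambda>c. c \<odot>\<^bsub>grG\<^esub> \<one>\<^bsub>grG\<^esub>) (carrier K) (gr_component A G 0)"
    unfolding bij_betw_def
  proof
    show "inj_on (\<lambda>c. c \<odot>\<^bsub>grG\<^esub> \<one>\<^bsub>grG\<^esub>) (carrier K)"
    proof (rule inj_onI, rule ccontr)
      fix c d
      assume c: "c \<in> carrier K" and d: "d \<in> carrier K" and "c \<noteq> d"
        and eq: "c \<odot>\<^bsub>grG\<^esub> \<one>\<^bsub>grG\<^esub> = d \<odot>\<^bsub>grG\<^esub> \<one>\<^bsub>grG\<^esub>"
      let ?e = "c \<ominus>\<^bsub>K\<^esub> d"
      have "c \<odot> \<one> \<ominus> d \<odot> \<one> \<in> G (- 1)"
        using eq GF.homog_eq_iff[of "c \<odot> \<one>" 0 "d \<odot> \<one>"] c d by (simp add: homog)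
      then have "?e \<odot> \<one> = \<zero>"
        using c d by (simp add: G_negative a_minus_def smult_l_distr smult_l_minus)
      moreover have e: "?e \<in> carrier K - {\<zero>\<^bsub>K\<^esub>}" using c d \<open>c \<noteq> d\<close> by simp
      then have "inv\<^bsub>K\<^esub> ?e \<in> carrier K" "inv\<^bsub>K\<^esub> ?e \<otimes>\<^bsub>K\<^esub> ?e = \<one>\<^bsub>K\<^esub>"
        by (simp_all add: K.field_Units)
      ultimately have "\<one>\<^bsub>K\<^esub> \<odot> \<one> = \<zero>"
        using e smult_assoc1[of "inv\<^bsub>K\<^esub> ?e" ?e \<one>] by simp
      with assms(2) show False by simp
    qed
    show "(\<lambda>c. c \<odot>\<^bsub>grG\<^esub> \<one>\<^bsub>grG\<^esub>) ` carrier K = gr_component A G 0"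
      using G_zero by (auto simp: homog GF.gr_component_eq)
  qed
qed

end

section \<open>Generators of a differential algebra of finite type\<close>

context unital_algebra
begin

lemma ring_centerI:
  "x \<in> carrier A \<Longrightarrow> (\<And>z. z \<in> carrier A \<Longrightarrow> x \<otimes> z = z \<otimes> x) \<Longrightarrow> x \<in> ring_center A"
  by (simp add: ring_center_def)

lemma
  assumes "x \<in> ring_center A"
  shows ring_center_carrier: "x \<in> carrier A"
    and ring_center_commute: "z \<in> carrier A \<Longrightarrow> x \<otimes> z = z \<otimes> x"
  using assms by (simp_all add: ring_center_def)

lemma ring_center_subring: "subring (ring_center A) A"
proof (rule subringI)
  fix x assume x: "x \<in> ring_center A"
  then show "\<ominus> x \<in> ring_center A"
    by (intro ring_centerI) (simp_all add: ring_center_carrier l_minus r_minus ring_center_commute[OF x])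
  fix y assume y: "y \<in> ring_center A"
  have "(x \<otimes> y) \<otimes> z = z \<otimes> (x \<otimes> y)" if z: "z \<in> carrier A" for z
  proof -
    have c: "x \<in> carrier A" "y \<in> carrier A" "x \<otimes> z = z \<otimes> x" "y \<otimes> z = z \<otimes> y"
      using ring_center_carrier ring_center_commute x y z by blast+
    have "(x \<otimes> y) \<otimes> z = x \<otimes> (z \<otimes> y)" unfolding c(4)[symmetric] using c(1,2) z by (rule m_assoc)
    also have "\<dots> = (x \<otimes> z) \<otimes> y" using c(1) z c(2) by (rule m_assoc[symmetric])
    also have "\<dots> = z \<otimes> (x \<otimes> y)" unfolding c(3) using z c(1,2) by (rule m_assoc)
    finally show ?thesis .
  qed
  with x y show "x \<otimes> y \<in> ring_center A" by (intro ring_centerI) (simp_all add: ring_center_carrier)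
  show "x \<oplus> y \<in> ring_center A"
    using x y by (intro ring_centerI)
      (simp_all add: ring_center_carrier l_distr r_distr ring_center_commute[OF x] ring_center_commute[OF y])
qed (auto simp: ring_center_carrier intro: ring_centerI)

lemma ring_center_smult: "c \<in> carrier K \<Longrightarrow> x \<in> ring_center A \<Longrightarrow> c \<odot> x \<in> ring_center A"
  by (intro ring_centerI)
    (simp_all add: ring_center_carrier smult_mult_left smult_mult_right ring_center_commute)

text \<open>The central elements that map \<open>P\<close> into itself form a subalgebra of the
  center, so stability needs to be checked only for algebra generators.\<close>

lemma finitely_generated_center_induct:
  assumes "(\<lambda>N. submodule N K (center_algebra A) \<and> subring N (center_algebra A)) hull T
      = carrier (center_algebra A)"
    and P: "submodule P K A" and T: "\<And>t p. t \<in> T \<Longrightarrow> p \<in> P \<Longrightarrow> t \<otimes> p \<in> P" "T \<subseteq> ring_center A"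
    and "z \<in> ring_center A" "p \<in> P"
  shows "z \<otimes> p \<in> P"
proof -
  define Q where "Q = {z \<in> ring_center A. \<forall>p\<in>P. z \<otimes> p \<in> P}"
  note C = subringE[OF ring_center_subring]
  note PE = submoduleE[OF P]
  have Pc: "p \<in> carrier A" if "p \<in> P" for p using that PE(1) by blast
  have Cc: "z \<in> carrier A" if "z \<in> ring_center A" for z using that C(1) by blast
  have Q: "subring Q A"
  proof (rule subringI)
    show "Q \<subseteq> carrier A" using Cc by (auto simp: Q_def)
    show "\<one> \<in> Q" using C(3) Pc by (auto simp: Q_def)
    fix x assume x: "x \<in> Q"
    show "\<ominus> x \<in> Q" using x C(5) PE(3) Pc Cc by (auto simp: Q_def l_minus)
    fix y assume y: "y \<in> Q"
    show "x \<otimes> y \<in> Q" using x y C(6) Pc Cc by (auto simp: Q_def m_assoc)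
    show "x \<oplus> y \<in> Q" using x y C(7) PE(5) Pc Cc by (auto simp: Q_def l_distr)
  qed
  have QC: "Q \<subseteq> ring_center A" by (auto simp: Q_def)
  \<comment> \<open>The hull is taken inside the center, so the closure properties of
    \<open>Q\<close> are restated for that structure.\<close>
  have "subgroup Q (add_monoid (center_algebra A))"
    using group.subgroup_incl[OF M.a_group subring.axioms(1)[OF Q] subring.axioms(1)[OF ring_center_subring] QC]
    by (simp add: center_algebra_def)
  moreover have "c \<odot> x \<in> Q" if "c \<in> carrier K" "x \<in> Q" for c x
    using that ring_center_smult PE(4) Pc Cc by (auto simp: Q_def smult_mult_left)
  moreover have "submonoid Q (center_algebra A)"
    using QC subringE(3,6)[OF Q] by (intro submonoid.intro) (auto simp: center_algebra_def)
  ultimately have "submodule Q K (center_algebra A)" "subring Q (center_algebra A)"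
    by (auto simp: submodule_def submodule_axioms_def subring_def center_algebra_def)
  moreover have "T \<subseteq> Q" using T by (auto simp: Q_def)
  ultimately have "carrier (center_algebra A) \<subseteq> Q"
    unfolding assms(1)[symmetric] by (intro hull_minimal) auto
  then show ?thesis using assms(5,6) by (auto simp: Q_def center_algebra_def)
qed

text \<open>The additive structure is that of \<open>A\<close> and only the scalars change, so
  stability under the center is all that has to be added.\<close>

lemma submodule_module_over_center:
  assumes "submodule P K A" "\<And>z p. z \<in> ring_center A \<Longrightarrow> p \<in> P \<Longrightarrow> z \<otimes> p \<in> P"
  shows "submodule P (center_algebra A) (module_over_center A)"
  using submodule.axioms(1)[OF assms(1)] assms(2)
  by (intro submodule.intro submodule_axioms.intro)
    (simp_all add: module_over_center_def center_algebra_def subgroup_def m_inv_def)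

end

text \<open>
  The lifts \<open>Z\<close> of homogeneous components of generators of the center, and the lifts \<open>Y\<close> of
  homogeneous components of module generators over the center, with their degrees.
\<close>

locale lifted_generators = nonnegative_filtered_algebra K A F for K and A (structure) and F +
  fixes Z Y :: "('c \<times> nat) set"
  assumes Z_finite: "finite Z" and Y_finite: "finite Y"
    and Z_in_F: "z \<in> Z \<Longrightarrow> fst z \<in> F (int (snd z))"
    and Y_in_F: "y \<in> Y \<Longrightarrow> fst y \<in> F (int (snd y))"
begin

section \<open>Spans of words in the lifted generators\<close>

lemma Z_carrier: "z \<in> Z \<Longrightarrow> fst z \<in> carrier A"
  by (rule F_in_carrier[OF Z_in_F])

lemma Y_carrier: "y \<in> Y \<Longrightarrow> fst y \<in> carrier A"
  by (rule F_in_carrier[OF Y_in_F])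

text \<open>\<open>I\<close> restricts the number of letters from \<open>Z\<close>, which
  \<open>n\<close> cannot bound when some letters have degree zero. It is \<open>UNIV\<close> when
  only the degree matters and \<open>{..L}\<close> for weight estimates.\<close>

definition words_in :: "nat set \<Rightarrow> int \<Rightarrow> 'c set" where
  "words_in I n = linear_span {val u \<otimes> fst y | u y.
     u \<in> lists Z \<and> y \<in> Y \<and> length u \<in> I \<and> int (weight u + snd y) \<le> n}"

lemma Z_word_in_F: "u \<in> lists Z \<Longrightarrow> val u \<in> F (int (weight u))"
proof (induction u)
  case (Cons z u)
  then show ?case by (auto intro!: F_mult[of _ "int (snd z)" _ "int (weight u)"] Z_in_F)
qed simp

lemma words_in_F: "v \<in> words_in I n \<Longrightarrow> v \<in> F n"
  unfolding words_in_def
proof (erule span_induct_submodule[OF filtration_submodule])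
  fix s assume "s \<in> {val u \<otimes> fst y | u y.
     u \<in> lists Z \<and> y \<in> Y \<and> length u \<in> I \<and> int (weight u + snd y) \<le> n}"
  then obtain u y where "u \<in> lists Z" "y \<in> Y" "int (weight u + snd y) \<le> n" "s = val u \<otimes> fst y" by blast
  then show "s \<in> F n" using F_mult[OF Z_word_in_F Y_in_F, of u y n] by auto
qed

lemma words_in_mono: "I \<subseteq> J \<Longrightarrow> m \<le> n \<Longrightarrow> words_in I m \<subseteq> words_in J n"
  unfolding words_in_def by (rule span_mono) fastforce

lemma words_in_submodule: "submodule (words_in I n) K A"
  unfolding words_in_def by (rule span_submodule)

lemma word_in_words_in:
  assumes "u \<in> lists Z" "y \<in> Y" "length u \<in> I" "int (weight u + snd y) \<le> n"
  shows "val u \<otimes> fst y \<in> words_in I n"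
  unfolding words_in_def
proof (rule linear_span.base)
  show "val u \<otimes> fst y \<in> carrier A"
    using F_in_carrier[OF Z_word_in_F[OF assms(1)]] Y_carrier[OF assms(2)] by simp
qed (use assms in blast)

lemma words_in_Z_mult:
  assumes z: "z \<in> Z" and v: "v \<in> words_in UNIV n"
  shows "fst z \<otimes> v \<in> words_in UNIV (int (snd z) + n)"
proof -
  have zc: "fst z \<in> carrier A" using z by (rule Z_carrier)
  have "fst z \<otimes> v \<in> linear_span {val u \<otimes> fst y | u y.
     u \<in> lists Z \<and> y \<in> Y \<and> length u \<in> UNIV \<and> int (weight u + snd y) \<le> int (snd z) + n}"
  proof (rule span_mult[of "{fst z}", OF _ _ v[unfolded words_in_def]])
    show "fst z \<in> linear_span {fst z}" using zc by (intro linear_span.base) auto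
    fix s t assume "s \<in> {fst z}" and "t \<in> {val u \<otimes> fst y | u y.
     u \<in> lists Z \<and> y \<in> Y \<and> length u \<in> UNIV \<and> int (weight u + snd y) \<le> n}"
    then obtain u y where uy: "u \<in> lists Z" "y \<in> Y" "int (weight u + snd y) \<le> n"
      "s = fst z" "t = val u \<otimes> fst y" by blast
    have "val u \<in> carrier A" "fst y \<in> carrier A"
      using F_in_carrier[OF Z_word_in_F[OF uy(1)]] Y_carrier[OF uy(2)] by auto
    then have "s \<otimes> t = val (z # u) \<otimes> fst y" using uy zc by (simp add: m_assoc)
    moreover have "val (z # u) \<otimes> fst y \<in> words_in UNIV (int (snd z) + n)"
      using uy z by (intro word_in_words_in) auto
    ultimately show "s \<otimes> t \<in> linear_span {val u \<otimes> fst y | u y.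
     u \<in> lists Z \<and> y \<in> Y \<and> length u \<in> UNIV \<and> int (weight u + snd y) \<le> int (snd z) + n}"
      by (simp add: words_in_def)
  qed
  then show ?thesis by (simp add: words_in_def)
qed

text \<open>One element is a combination of finitely many words; the bound \<open>L\<close> depends
  on the element.\<close>

lemma words_in_bounded:
  assumes "v \<in> words_in UNIV n" shows "\<exists>L. v \<in> words_in {..L} n"
  using assms[unfolded words_in_def]
proof (induction rule: linear_span.induct)
  case zero
  show ?case unfolding words_in_def by (intro exI linear_span.zero)
next
  case (base s)
  then obtain u y where "u \<in> lists Z" "y \<in> Y" "int (weight u + snd y) \<le> n" "s = val u \<otimes> fst y" by blast
  then show ?case using word_in_words_in[of u y "{..length u}" n] by auto
next
  case (add v w)
  then obtain L M where LM: "v \<in> words_in {..L} n" "w \<in> words_in {..M} n" by blast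
  have "v \<in> words_in {..max L M} n" "w \<in> words_in {..max L M} n"
    using LM words_in_mono[of "{..L}" "{..max L M}" n n] words_in_mono[of "{..M}" "{..max L M}" n n] by auto
  then have "v \<oplus> w \<in> words_in {..max L M} n" by (rule submoduleE(5)[OF words_in_submodule])
  then show ?case by blast
next
  case (smult c v)
  then show ?case using submoduleE(4)[OF words_in_submodule] by blast
qed

lemma words_in_uniformly_bounded:
  assumes "finite D" "\<And>v n. (v, n) \<in> D \<Longrightarrow> v \<in> words_in UNIV n"
  shows "\<exists>L. \<forall>(v, n) \<in> D. v \<in> words_in {..L} n"
  using assms
proof (induction D rule: finite_induct)
  case (insert p D)
  obtain v n where p: "p = (v, n)" by (cases p)
  from insert obtain L where L: "\<forall>(v, n) \<in> D. v \<in> words_in {..L} n" by auto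
  obtain M where M: "v \<in> words_in {..M} n" using insert.prems words_in_bounded p by blast
  have "words_in {..L} k \<subseteq> words_in {..max L M} k" "words_in {..M} k \<subseteq> words_in {..max L M} k" for k
    by (rule words_in_mono; force)+
  then show ?case using L M p by (intro exI[of _ "max L M"]) blast
qed auto

end

text \<open>
  The weights are \<open>N d + 1\<close> and \<open>N e + W\<close> with \<open>W > L\<close> and \<open>N \<ge> L + W - 1\<close>, where \<open>L\<close> bounds the number of
  factors from \<open>Z\<close> in the finitely many words that express the commutators and the products \<open>y y'\<close>.
\<close>

locale spanning_lifted_generators = lifted_generators +
  assumes F_words: "F n \<subseteq> words_in UNIV n"
    and Z_commutator: "z \<in> Z \<Longrightarrow> x \<in> F n \<Longrightarrow> fst z \<otimes> x \<ominus> x \<otimes> fst z \<in> F (int (snd z) + n - 1)"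
    and F_exhaustive: "carrier A = (\<Union>n. F n)"
begin

lemma weighted_generators_exist: "\<exists>E. weighted_generators K A E"
proof -
  \<comment> \<open>The expressions to be rewritten, each with a degree bound: a bracket with a
    letter from \<open>Z\<close> drops by one, a product of two letters from \<open>Y\<close> does
    not drop.\<close>
  define D where "D =
    (\<lambda>(z, w). (fst z \<otimes> fst w \<ominus> fst w \<otimes> fst z, int (snd z) + int (snd w) - 1)) ` (Z \<times> (Z \<union> Y)) \<union>
    (\<lambda>(y, w). (fst y \<otimes> fst w, int (snd y) + int (snd w))) ` (Y \<times> Y)"
  have "finite D" using Z_finite Y_finite by (simp add: D_def)
  moreover have "v \<in> words_in UNIV n" if "(v, n) \<in> D" for v n
  proof -
    have "v \<in> F n"
      using that Z_commutator Z_in_F Y_in_F filtration_mult by (auto simp: D_def)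
    then show ?thesis using F_words by blast
  qed
  ultimately obtain L where L: "\<forall>(v, n) \<in> D. v \<in> words_in {..L} n"
    using words_in_uniformly_bounded by blast
  \<comment> \<open>Rewritten words of degree \<open>n\<close> get weight at most
    \<open>N n + L + W\<close>. Comparison with the weights of the two letters, less one, requires
    \<open>L + W \<le> N + 1\<close> for two letters from \<open>Z\<close>, \<open>L \<le> N\<close>
    for mixed letters and \<open>L + 1 \<le> W\<close> for two letters from
    \<open>Y\<close>.\<close>
  define N where "N = 2 * L + 1"
  define W where "W = L + 1"
  define z_gen where "z_gen = (\<lambda>z :: 'c \<times> nat. (fst z, N * snd z + 1))"
  define y_gen where "y_gen = (\<lambda>y :: 'c \<times> nat. (fst y, N * snd y + W))"
  define E where "E = z_gen ` Z \<union> y_gen ` Y"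
  have E_carrier: "fst ` E \<subseteq> carrier A"
    using Z_carrier Y_carrier by (force simp: E_def z_gen_def y_gen_def)
  have val_map: "val (map z_gen u) = val u" and weight_map: "weight (map z_gen u) = N * weight u + length u"
    for u by (induction u) (simp_all add: z_gen_def algebra_simps)
  have word: "val (map z_gen u @ [y_gen y]) = val u \<otimes> fst y"
    "map z_gen u @ [y_gen y] \<in> lists E"
    "weight (map z_gen u @ [y_gen y]) = N * (weight u + snd y) + length u + W"
    if "u \<in> lists Z" "y \<in> Y" for u y
  proof -
    have mem: "map z_gen u \<in> lists E" "[y_gen y] \<in> lists E" using that by (auto simp: E_def)
    then show "map z_gen u @ [y_gen y] \<in> lists E" by simp
    have "fst y \<in> carrier A" using that by (intro Y_carrier)
    then show "val (map z_gen u @ [y_gen y]) = val u \<otimes> fst y"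
      using val_append[OF mem E_carrier] by (simp add: val_map y_gen_def)
    show "weight (map z_gen u @ [y_gen y]) = N * (weight u + snd y) + length u + W"
      by (simp add: weight_map) (simp add: y_gen_def algebra_simps)
  qed
  \<comment> \<open>The degree \<open>n\<close> is an integer, as the bracket of two letters of
    degree zero has the bound \<open>- 1\<close>; there are no words then and the span is
    zero.\<close>
  have bounded: "v \<in> weight_filtration E m"
    if "v \<in> words_in {..L} n" "int N * n + int L + int W \<le> m" for v n m
  proof -
    have "{val u \<otimes> fst y | u y. u \<in> lists Z \<and> y \<in> Y \<and> length u \<in> {..L} \<and> int (weight u + snd y) \<le> n}
        \<subseteq> val ` {u \<in> lists E. int (weight u) \<le> m}"
    proof
      fix x assume "x \<in> {val u \<otimes> fst y | u y. u \<in> lists Z \<and> y \<in> Y \<and> length u \<in> {..L} \<and> int (weight u + snd y) \<le> n}"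
      then obtain u y where u: "u \<in> lists Z" "y \<in> Y" "length u \<in> {..L}" "int (weight u + snd y) \<le> n"
        and x: "x = val u \<otimes> fst y" by blast
      have "int N * int (weight u + snd y) \<le> int N * n" using u(4) by (rule mult_left_mono) simp
      then have "int (weight (map z_gen u @ [y_gen y])) \<le> m"
        using that(2) u(3) unfolding word(3)[OF u(1,2)] by simp
      then show "x \<in> val ` {u \<in> lists E. int (weight u) \<le> m}"
        unfolding x using word(1,2)[OF u(1,2)] by (intro image_eqI[of _ _ "map z_gen u @ [y_gen y]"]) auto
    qed
    from span_mono[OF this] that(1) show ?thesis by (auto simp: words_in_def weight_filtration_def)
  qed
  have sub: "submodule (weight_filtration E m) K A" for m
    unfolding weight_filtration_def by (rule span_submodule)
  have Z_comm: "fst z \<otimes> fst w \<ominus> fst w \<otimes> fst z \<in> weight_filtration E m"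
    if "z \<in> Z" "w \<in> Z \<union> Y" "int N * (int (snd z) + int (snd w) - 1) + int L + int W \<le> m" for z w m
    using that L by (intro bounded[of _ "int (snd z) + int (snd w) - 1"]) (auto simp: D_def)
  have Y_mult: "fst y \<otimes> fst w \<in> weight_filtration E m"
    if "y \<in> Y" "w \<in> Y" "int N * (int (snd y) + int (snd w)) + int L + int W \<le> m" for y w m
    using that L by (intro bounded[of _ "int (snd y) + int (snd w)"]) (auto simp: D_def)
  have "weighted_generators K A E"
  proof (intro weighted_generators.intro weighted_generators_axioms.intro unital_algebra_axioms E_carrier)
    show "finite E" using Z_finite Y_finite by (simp add: E_def)
    show "0 < snd x" if "x \<in> E" for x using that by (auto simp: E_def z_gen_def y_gen_def W_def)
    show "linear_span (val ` lists E) = carrier A"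
    proof (intro subset_antisym subsetI)
      fix x assume "x \<in> carrier A"
      then obtain n where "x \<in> words_in UNIV n" using F_exhaustive F_words by blast
      moreover have "{val u \<otimes> fst y | u y. u \<in> lists Z \<and> y \<in> Y \<and> length u \<in> UNIV \<and> int (weight u + snd y) \<le> n}
        \<subseteq> val ` lists E"
        using word(1,2) by (fastforce intro: image_eqI[OF sym])
      ultimately show "x \<in> linear_span (val ` lists E)" using span_mono unfolding words_in_def by blast
    qed (rule span_carrier)
    fix a b assume "a \<in> E" "b \<in> E"
    let ?m = "int (snd a) + int (snd b) - 1"
    consider (ZZ) z w where "z \<in> Z" "w \<in> Z" "a = z_gen z" "b = z_gen w"
      | (ZY) z w where "z \<in> Z" "w \<in> Y" "a = z_gen z" "b = y_gen w"
      | (YZ) z w where "z \<in> Y" "w \<in> Z" "a = y_gen z" "b = z_gen w"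
      | (YY) z w where "z \<in> Y" "w \<in> Y" "a = y_gen z" "b = y_gen w"
      using \<open>a \<in> E\<close> \<open>b \<in> E\<close> by (auto simp: E_def)
    then show "fst a \<otimes> fst b \<ominus> fst b \<otimes> fst a \<in> weight_filtration E ?m"
    proof cases
      case ZZ
      then have "fst z \<otimes> fst w \<ominus> fst w \<otimes> fst z \<in> weight_filtration E ?m"
        by (intro Z_comm) (auto simp: z_gen_def N_def W_def algebra_simps)
      with ZZ show ?thesis by (simp add: z_gen_def)
    next
      case ZY
      then have "fst z \<otimes> fst w \<ominus> fst w \<otimes> fst z \<in> weight_filtration E ?m"
        by (intro Z_comm) (auto simp: z_gen_def y_gen_def N_def W_def algebra_simps)
      with ZY show ?thesis by (simp add: z_gen_def y_gen_def)
    next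
      case YZ
      then have "fst w \<otimes> fst z \<ominus> fst z \<otimes> fst w \<in> weight_filtration E ?m"
        by (intro Z_comm) (auto simp: z_gen_def y_gen_def N_def W_def algebra_simps)
      moreover have "fst z \<in> carrier A" "fst w \<in> carrier A" using YZ Z_carrier Y_carrier by blast+
      ultimately have "fst z \<otimes> fst w \<ominus> fst w \<otimes> fst z \<in> weight_filtration E ?m"
        using commutator_swap[OF sub] by blast
      with YZ show ?thesis by (simp add: z_gen_def y_gen_def)
    next
      \<comment> \<open>No cancellation is used: both products lie in the smaller piece
        separately.\<close>
      case YY
      then have "fst z \<otimes> fst w \<in> weight_filtration E ?m" "fst w \<otimes> fst z \<in> weight_filtration E ?m"
        by (intro Y_mult; auto simp: y_gen_def N_def W_def algebra_simps)+
      then have "fst z \<otimes> fst w \<ominus> fst w \<otimes> fst z \<in> weight_filtration E ?m"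
        unfolding weight_filtration_def by (rule span_minus)
      with YY show ?thesis by (simp add: y_gen_def)
    qed
  qed
  then show ?thesis ..
qed

end

section \<open>Lifting generators from the associated graded algebra\<close>

context nonnegative_filtered_algebra
begin

lemma spanning_lifted_generators_exist:
  assumes exhaustive: "exhaustive_filtration A F"
    and fgm: "finitely_generated_module (center_algebra gr) (module_over_center gr)"
    and fga: "finitely_generated_algebra K (center_algebra gr)"
  shows "\<exists>Z Y. spanning_lifted_generators K A F Z Y"
proof -
  interpret gr: unital_algebra K gr by unfold_locales
  obtain S where S: "finite S" "S \<subseteq> carrier gr"
    "(\<lambda>N. submodule N (center_algebra gr) (module_over_center gr)) hull S = carrier gr"
    using fgm by (auto simp: finitely_generated_module_def module_over_center_def)
  obtain T where T: "finite T" "T \<subseteq> ring_center gr"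
    "(\<lambda>N. submodule N K (center_algebra gr) \<and> subring N (center_algebra gr)) hull T = carrier (center_algebra gr)"
    using fga by (auto simp: finitely_generated_algebra_def center_algebra_def)
  have T_carrier: "T \<subseteq> carrier gr" using T(2) by (auto simp: ring_center_def)
  have "\<forall>f\<in>carrier gr. \<exists>x. (\<forall>i. x i \<in> F i) \<and> (\<forall>i. f i = F (i - 1) +> x i) \<and> finite {i. x i \<noteq> \<zero>}"
    using gr_repr by metis
  then obtain r where r: "\<And>f i. f \<in> carrier gr \<Longrightarrow> r f i \<in> F i"
    "\<And>f i. f \<in> carrier gr \<Longrightarrow> f i = F (i - 1) +> r f i"
    "\<And>f. f \<in> carrier gr \<Longrightarrow> finite {i. r f i \<noteq> \<zero>}"
    by metis
  have r_nonneg: "0 \<le> i" if "f \<in> carrier gr" "r f i \<noteq> \<zero>" for f i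
    using r(1)[OF that(1), of i] that(2) F_negative[of i] by (cases "i < 0") auto
  \<comment> \<open>All nonzero homogeneous parts of the generators are lifted. Their degrees are
    nonnegative, so \<open>nat\<close> loses nothing.\<close>
  define lifts where "lifts U = (\<Union>f\<in>U. (\<lambda>i. (r f i, nat i)) ` {i. r f i \<noteq> \<zero>})" for U
  have lifts_finite: "finite (lifts U)" if "finite U" "U \<subseteq> carrier gr" for U
    using that r(3) by (auto simp: lifts_def)
  have lifts_in_F: "fst x \<in> F (int (snd x))" if x: "x \<in> lifts U" "U \<subseteq> carrier gr" for x U
  proof -
    obtain f i where f: "f \<in> carrier gr" "r f i \<noteq> \<zero>" "x = (r f i, nat i)"
      using x by (auto simp: lifts_def)
    then show ?thesis using r(1)[of f i] r_nonneg[of f i] by simp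
  qed
  have lifts_mem: "(r f i, nat i) \<in> lifts U" "int (nat i) = i"
    if "f \<in> U" "U \<subseteq> carrier gr" "r f i \<noteq> \<zero>" for f i U
  proof -
    show "(r f i, nat i) \<in> lifts U" using that by (auto simp: lifts_def)
    show "int (nat i) = i" using that r_nonneg[of f i] by auto
  qed
  define Z where "Z = lifts T"
  define Y where "Y = lifts S"
  interpret L: lifted_generators K A F Z Y
    using S T T_carrier lifts_finite lifts_in_F by unfold_locales (auto simp: Z_def Y_def)
  define V where "V = L.words_in UNIV"
  have V_sub: "submodule (V n) K A" for n unfolding V_def by (rule L.words_in_submodule)
  have V_F: "v \<in> F n" if "v \<in> V n" for v n using that L.words_in_F unfolding V_def by blast
  have V_zero: "\<zero> \<in> V n" for n using subgroup.one_closed[OF submodule.axioms(1)[OF V_sub]] by simp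
  have V_finsum: "finsum A g J \<in> V n" if "\<And>j. j \<in> J \<Longrightarrow> g j \<in> V n" for g J n
    using that
  proof (induction J rule: infinite_finite_induct)
    case (insert j J)
    then have "g \<in> J \<rightarrow> carrier A" "g j \<in> carrier A" using V_F by blast+
    with insert show ?case using submoduleE(5)[OF V_sub] by simp
  qed (simp_all add: V_zero)
  \<comment> \<open>\<open>P\<close> consists of the families representable by words in every
    degree. Once it is known to be all of \<open>gr\<close>, every \<open>F n\<close> lies in
    \<open>V n + F (n - 1)\<close>.\<close>
  define P where "P = {f \<in> carrier gr. \<forall>n. \<exists>v \<in> V n. f n = F (n - 1) +> v}"
  have P_repr: "\<exists>v. (\<forall>n. v n \<in> V n) \<and> (\<forall>n. f n = F (n - 1) +> v n)" if "f \<in> P" for f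
  proof -
    have "\<forall>n. \<exists>v. v \<in> V n \<and> f n = F (n - 1) +> v" using that by (auto simp: P_def)
    then obtain v where "\<forall>n. v n \<in> V n \<and> f n = F (n - 1) +> v n" by (rule choice[THEN exE])
    then show ?thesis by blast
  qed
  have P_sub: "submodule P K gr"
  proof (rule gr.submoduleI)
    show "\<zero>\<^bsub>gr\<^esub> \<in> P"
      using gr_zero_carrier V_zero by (auto simp: P_def gr_zero F_carrier intro!: bexI[of _ \<zero>])
    fix f assume f: "f \<in> P"
    obtain v where v: "\<And>n. v n \<in> V n" "\<And>n. f n = F (n - 1) +> v n" using P_repr[OF f] by blast
    show sm: "c \<odot>\<^bsub>gr\<^esub> f \<in> P" if "c \<in> carrier K" for c
    proof -
      have "(c \<odot>\<^bsub>gr\<^esub> f) n = F (n - 1) +> c \<odot> v n" for n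
        by (rule gr_smult_eval[OF that V_F[OF v(1)] v(2)])
      moreover have "c \<odot> v n \<in> V n" for n using submoduleE(4)[OF V_sub that] v by blast
      ultimately show ?thesis using f that by (auto simp: P_def)
    qed
    have "\<ominus>\<^bsub>gr\<^esub> f = (\<ominus>\<^bsub>K\<^esub> \<one>\<^bsub>K\<^esub>) \<odot>\<^bsub>gr\<^esub> f"
      using gr.smult_l_minus[of "\<one>\<^bsub>K\<^esub>" f] f by (simp add: P_def)
    then show "\<ominus>\<^bsub>gr\<^esub> f \<in> P" using sm by simp
    fix g assume g: "g \<in> P"
    obtain w where w: "\<And>n. w n \<in> V n" "\<And>n. g n = F (n - 1) +> w n" using P_repr[OF g] by blast
    have "(f \<oplus>\<^bsub>gr\<^esub> g) n = F (n - 1) +> (v n \<oplus> w n)" for n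
      by (rule gr_add_eval[OF V_F[OF v(1)] V_F[OF w(1)] v(2) w(2)])
    moreover have "v n \<oplus> w n \<in> V n" for n using submoduleE(5)[OF V_sub] v w by blast
    ultimately show "f \<oplus>\<^bsub>gr\<^esub> g \<in> P" using f g by (auto simp: P_def)
  qed (auto simp: P_def)
  \<comment> \<open>Multiplication by \<open>t\<close> is the sum of the multiplications by its
    homogeneous parts, and each of these prepends a letter from \<open>Z\<close> to the
    words.\<close>
  have T_mult: "t \<otimes>\<^bsub>gr\<^esub> p \<in> P" if t: "t \<in> T" and p: "p \<in> P" for t p
  proof -
    have tc: "t \<in> carrier gr" using t T_carrier by blast
    obtain v where v: "\<And>n. v n \<in> V n" "\<And>n. p n = F (n - 1) +> v n" using P_repr[OF p] by blast
    have "(t \<otimes>\<^bsub>gr\<^esub> p) n = F (n - 1) +> (\<Oplus>i\<in>{i. r t i \<noteq> \<zero>}. r t i \<otimes> v (n - i))" for n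
      by (rule gr_mult_eval[OF r(1,2)[OF tc] V_F[OF v(1)] v(2) gr_support_finite[OF tc] r(3)[OF tc]]) simp
    moreover have "(\<Oplus>i\<in>{i. r t i \<noteq> \<zero>}. r t i \<otimes> v (n - i)) \<in> V n" for n
    proof (rule V_finsum)
      fix i assume "i \<in> {i. r t i \<noteq> \<zero>}"
      then show "r t i \<otimes> v (n - i) \<in> V n"
        using L.words_in_Z_mult[of "(r t i, nat i)" "v (n - i)" "n - i"] v(1)[of "n - i"]
          lifts_mem[OF t T_carrier, of i] by (simp add: V_def Z_def)
    qed
    ultimately show ?thesis using tc p by (auto simp: P_def)
  qed
  have "submodule P (center_algebra gr) (module_over_center gr)"
    by (rule gr.submodule_module_over_center[OF P_sub
          gr.finitely_generated_center_induct[OF T(3) P_sub T_mult T(2)]])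
  moreover have "S \<subseteq> P"
  proof
    fix s assume s: "s \<in> S"
    have "r s n \<in> V n" for n
    proof (cases "r s n = \<zero>")
      case False
      have "r s n \<in> carrier A" using r(1) s S(2) by blast
      then show ?thesis
        using lifts_mem[OF s S(2) False] L.word_in_words_in[of "[]" "(r s n, nat n)" UNIV n]
        by (simp add: V_def Y_def)
    qed (simp add: V_zero)
    moreover have "s n = F (n - 1) +> r s n" for n using r(2) s S(2) by blast
    ultimately show "s \<in> P" unfolding P_def using s S(2) by blast
  qed
  ultimately have P: "carrier gr \<subseteq> P" unfolding S(3)[symmetric] by (intro hull_minimal) auto
  \<comment> \<open>\<open>P\<close> being everything is applied to the symbol of \<open>a\<close>,
    and its coset in degree \<open>n\<close> is read off.\<close>
  have F_step: "\<exists>v \<in> V n. a \<ominus> v \<in> F (n - 1)" if a: "a \<in> F n" for a n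
  proof -
    have "homog n a \<in> P" using P a by auto
    then obtain v where v: "v \<in> V n" "homog n a n = F (n - 1) +> v" unfolding P_def by blast
    then have "a \<ominus> v \<in> F (n - 1)"
      using coset_eq_iff[OF F_in_carrier[OF a] F_in_carrier[OF V_F[OF v(1)]]] by simp
    with v(1) show ?thesis by blast
  qed
  have F_V_step: "F n \<subseteq> V n" if IH: "F (n - 1) \<subseteq> V (n - 1)" for n
  proof
    fix a assume a: "a \<in> F n"
    then obtain v where v: "v \<in> V n" "a \<ominus> v \<in> F (n - 1)" using F_step by blast
    have "V (n - 1) \<subseteq> V n" unfolding V_def by (rule L.words_in_mono) auto
    with v IH have "(a \<ominus> v) \<oplus> v \<in> V n" using submoduleE(5)[OF V_sub] by blast
    moreover have "(a \<ominus> v) \<oplus> v = a"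
      using F_in_carrier[OF a] F_in_carrier[OF V_F[OF v(1)]] by (simp add: a_minus_def M.a_assoc M.l_neg)
    ultimately show "a \<in> V n" by simp
  qed
  \<comment> \<open>The shift by one lets the induction start at \<open>F (- 1)\<close>, which is
    zero.\<close>
  have F_V_nat: "F (int k - 1) \<subseteq> V (int k - 1)" for k
  proof (induction k)
    case (Suc k)
    then show ?case using F_V_step[of "int k"] by simp
  qed (simp add: nonnegative V_zero)
  have F_V: "F n \<subseteq> V n" for n
    using F_V_nat[of "nat n + 1"] F_negative[of n] V_zero[of n] by (cases "n < 0") auto
  have "fst z \<otimes> a \<ominus> a \<otimes> fst z \<in> F (int (snd z) + n - 1)" if z: "z \<in> Z" and a: "a \<in> F n" for z a n
  proof -
    obtain t i where t: "t \<in> T" "r t i \<noteq> \<zero>" "z = (r t i, nat i)"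
      using z by (auto simp: Z_def lifts_def)
    have tc: "t \<in> carrier gr" using t T_carrier by blast
    \<comment> \<open>Only the whole generator \<open>t\<close> is known to be central. As
      \<open>homog n a\<close> sits in degree \<open>n\<close> alone, comparing the two products in
      degree \<open>i + n\<close> isolates the part of \<open>t\<close> of degree \<open>i\<close>,
      so its lift commutes with \<open>a\<close> up to lower degree.\<close>
    have "t \<otimes>\<^bsub>gr\<^esub> homog n a = homog n a \<otimes>\<^bsub>gr\<^esub> t"
      using t T(2) a by (auto simp: ring_center_def)
    moreover have "(t \<otimes>\<^bsub>gr\<^esub> homog n a) (i + n) = F (i + n - 1) +> r t (i + n - n) \<otimes> a"
      by (rule mult_homog_eval[OF tc r(1,2)[OF tc] a])
    moreover have "(homog n a \<otimes>\<^bsub>gr\<^esub> t) (i + n) = F (i + n - 1) +> a \<otimes> r t (i + n - n)"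
      by (rule homog_mult_eval[OF a r(1,2)[OF tc]])
    ultimately have "F (i + n - 1) +> r t i \<otimes> a = F (i + n - 1) +> a \<otimes> r t i" by simp
    then show ?thesis
      using t r_nonneg[OF tc t(2)] a F_in_carrier[OF r(1)[OF tc, of i]] by (simp add: coset_eq_iff)
  qed
  then have "spanning_lifted_generators K A F Z Y"
    using F_V exhaustive
    by unfold_locales (auto simp: V_def exhaustive_filtration_def)
  then show ?thesis by blast
qed

end

theorem theorem0p1:
  fixes K :: "('k, 'n) ring_scheme" and A :: "('k, 'a, 'm) module_scheme"
  assumes "field K"
    and "differential_algebra_of_finite_type K A"
    and "\<one>\<^bsub>A\<^esub> \<noteq> \<zero>\<^bsub>A\<^esub>"
  shows "\<exists>G. algebra_filtration K A G \<and> nonnegative_filtration A G \<and> exhaustive_filtration A G \<and>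
           cring (assoc_graded A G) \<and>
           finitely_generated_algebra K (assoc_graded A G) \<and>
           connected_graded_algebra K (assoc_graded A G) (gr_component A G)"
proof -
  obtain F where F: "algebra_filtration K A F" "nonnegative_filtration A F" "exhaustive_filtration A F"
    "finitely_generated_module (center_algebra (assoc_graded A F)) (module_over_center (assoc_graded A F))"
    "finitely_generated_algebra K (center_algebra (assoc_graded A F))"
    using assms(2) unfolding differential_algebra_of_finite_type_def by blast
  interpret F: nonnegative_filtered_algebra K A F
    using F(1,2) by (simp add: nonnegative_filtered_algebra_def nonnegative_filtered_algebra_axioms_def
        nonnegative_filtration_def)
  obtain Z Y where "spanning_lifted_generators K A F Z Y"
    using F.spanning_lifted_generators_exist[OF F(3-5)] by blast
  then obtain E where "weighted_generators K A E"
    using spanning_lifted_generators.weighted_generators_exist by blast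
  then interpret E: weighted_generators K A E .
  show ?thesis
    using E.GF.algebra_filtration_axioms E.GF.nonnegative E.G_exhaustive E.grG_cring
      E.grG_finitely_generated E.grG_connected[OF assms(1,3)]
    by (intro exI[of _ E.G]) (simp add: nonnegative_filtration_def)
qed

end
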